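(* Let the conditions (K1)--(K4) of the context be satisfied, and suppose that the solution $u$ of $\dot u+A(u)u=0$ on $[0,T]$ has the regularity $u\in C^{q+2}([0,T],Y)$ with $Su\in C^{q+1}([0,T],Y)$. Consider an algebraically stable and coercive $m$-stage Runge--Kutta method with stage order $q$ and quadrature order at least $q+1$ (all notions as in the context), applied with stepsize $\tau$ and $u_0=u(0)$: $$U_{ni}=u_n+\tau\sum_{j=1}^m a_{ij}\dot U_{nj},\quad \dot U_{ni}+A(U_{ni})U_{ni}=0\quad(i=1,\dots,m),\qquad u_{n+1}=u_n+\tau\sum_{i=1}^m b_i\dot U_{ni}.$$ Then there exists $\bar\tau>0$ such that for stepsizes $0<\tau\le\bar\tau$, the errors are bounded, with $t_n=n\tau$, by $$\|u_n-u(t_n)\|\le C\tau^{q+1},$$ where $C$ is independent of $n$ and $\tau$ with $0\le n\tau\le T$.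
   Context: Let $X$ and $Y$ be real Hilbert spaces such that $Y$ is densely and continuously embedded in $X$. The inner product on $X$ is $(\cdot,\cdot)$, the norms are $|\cdot|=\|\cdot\|_X$ and $\|\cdot\|=\|\cdot\|_Y$, chosen such that $|y|\le\|y\|$ for all $y\in Y$. For every $y\in Y$, $A(y)$ is a closed linear operator on $X$ with domain $D(A(y))$. For every $R>0$ the following conditions hold, with real numbers $M_R^A,M_R^B,L_R^A,L_R^B$ depending only on $R$. (K1) For every $y\in Y$, $A(y)$ has the open left complex half-plane in its resolvent set (in the sense of the complexification) and satisfies $(w,A(y)w)\ge0$ for all $w\in D(A(y))$. Moreover $Y\subset D(A(y))$, and for $\|y\|\le R$, $|A(y)w|\le M_R^A\|w\|$ for all $w\in Y$. (K2) There is an isometry $S:Y\to X$, self-adjoint as a linear operator on $X$ (with domain $Y$), such that for every $y\in Y$ with $\|y\|\le R$, $SA(y)S^{-1}=A(y)+B(y)$ (with equality of domains), where $|B(y)v|\le M_R^B|v|$ for all $v\in X$. (K3) For all $y,\widetilde y\in Y$ with $\|y\|\le R$, $\|\widetilde y\|\le R$: $|(A(y)-A(\widetilde y))w|\le L_R^A|y-\widetilde y|\,\|w\|$ for all $w\in Y$, and $|(B(y)-B(\widetilde y))v|\le L_R^B\|y-\widetilde y\|\,|v|$ for all $v\in X$. (K4) is a local Lipschitz condition in $X$ and $Y$ on a semilinear term $f(u)$ on the right-hand side of the evolution equation; since $f=0$ here, it holds trivially. In the Runge--Kutta equations the dot in $\dot U_{ni}$ is only notation: $\dot U_{ni}=-A(U_{ni})U_{ni}$.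 Nodes: $c_i=\sum_{j=1}^m a_{ij}$. Stage order $q$: $\sum_{j=1}^m a_{ij}c_j^{k-1}=c_i^k/k$ for $i=1,\dots,m$ and $k=1,\dots,q$. Quadrature order at least $q+1$: $\sum_{j=1}^m b_jc_j^{k-1}=1/k$ for $k=1,\dots,q+1$. Coercivity: the matrix $\mathcal O=(a_{ij})\in\mathbb R^{m\times m}$ is invertible and there exist a positive diagonal matrix $\mathcal D=\mathrm{diag}(d_i)$ and $\alpha>0$ such that $v^T\mathcal D\mathcal O^{-1}v\ge\alpha\,v^T\mathcal Dv$ for all $v\in\mathbb R^m$. Algebraic stability: the weights $b_i$ are positive, and the matrix with entries $b_ia_{ij}+b_ja_{ji}-b_ib_j$ is positive semidefinite. Convention on the numerical solution: there is a constant $C_*$ depending only on the Runge--Kutta coefficients such that for every $\rho>0$ and $\|u_n\|\le\rho$ the equations for the stages have, for sufficiently small $\tau$ (depending on $\rho$), a unique solution $(U_{ni})\in Y^m$ with $|U_{ni}|\le C_*|u_n|$ and $\|U_{ni}\|\le C_*\|u_n\|$. Such a $C_*$ is fixed, and the numerical solution is the one with these stages.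
   Formalization: If q ≥ 2, all nodes are additionally assumed to satisfy 0 ≤ c_i ≤ 1; without this the claim fails, because stages beyond the ends of [0,T], where A is only Lipschitz, can cause an error of order τ². *)

theory Defs
  imports "HOL-Analysis.Analysis"
begin

section \<open>Unbounded operators\<close>

text \<open>
  An operator on a real Hilbert space is given by its domain \<open>D\<close> and a function \<open>T\<close>; the values of
  \<open>T\<close> outside \<open>D\<close> carry no meaning.
\<close>

definition linear_operator :: "'x::real_vector set \<Rightarrow> ('x \<Rightarrow> 'x) \<Rightarrow> bool" where
  "linear_operator D T \<longleftrightarrow> subspace D \<and>
     (\<forall>v\<in>D. \<forall>w\<in>D. T (v + w) = T v + T w) \<and> (\<forall>c. \<forall>v\<in>D. T (c *\<^sub>R v) = c *\<^sub>R T v)"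

definition operator_graph :: "'x set \<Rightarrow> ('x \<Rightarrow> 'x) \<Rightarrow> ('x \<times> 'x) set" where
  "operator_graph D T = {(v, T v) |v. v \<in> D}"

definition closed_linear_operator :: "'x::real_normed_vector set \<Rightarrow> ('x \<Rightarrow> 'x) \<Rightarrow> bool" where
  "closed_linear_operator D T \<longleftrightarrow> linear_operator D T \<and> closed (operator_graph D T)"

definition adjoint_graph :: "'x::real_inner set \<Rightarrow> ('x \<Rightarrow> 'x) \<Rightarrow> ('x \<times> 'x) set" where
  "adjoint_graph D T = {(v, z). \<forall>w\<in>D. inner (T w) v = inner w z}"

definition self_adjoint_operator :: "'x::real_inner set \<Rightarrow> ('x \<Rightarrow> 'x) \<Rightarrow> bool" where
  "self_adjoint_operator D T \<longleftrightarrow>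
     linear_operator D T \<and> closure D = UNIV \<and> adjoint_graph D T = operator_graph D T"

text \<open>
  The complexification of \<open>'x\<close> is \<open>'x \<times> 'x\<close>, with \<open>(v, w)\<close> standing for \<open>v + \<i>w\<close>.  The
  norm of the product type is the Hilbert norm of the complexification.
\<close>

definition cscale :: "complex \<Rightarrow> 'x::real_vector \<times> 'x \<Rightarrow> 'x \<times> 'x" where
  "cscale l z = (Re l *\<^sub>R fst z - Im l *\<^sub>R snd z, Re l *\<^sub>R snd z + Im l *\<^sub>R fst z)"

definition complexify :: "('x \<Rightarrow> 'x) \<Rightarrow> 'x \<times> 'x \<Rightarrow> 'x \<times> 'x" where
  "complexify T z = (T (fst z), T (snd z))"

definition resolvent_set :: "'x::real_normed_vector set \<Rightarrow> ('x \<Rightarrow> 'x) \<Rightarrow> complex set" where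
  "resolvent_set D T =
     {l. bij_betw (\<lambda>z. cscale l z - complexify T z) (D \<times> D) UNIV \<and>
         (\<exists>K. \<forall>z\<in>D \<times> D. norm z \<le> K * norm (cscale l z - complexify T z))}"

section \<open>The conditions on the evolution equation\<close>

text \<open>
  The spaces \<open>X\<close> and \<open>Y\<close> are the types \<open>'x\<close> and \<open>'y\<close>, and \<open>J\<close> is the embedding of \<open>Y\<close> into \<open>X\<close>;
  so \<open>norm (J y)\<close> is the \<open>X\<close>-norm of \<open>y\<close> and \<open>norm y\<close> its \<open>Y\<close>-norm.
\<close>

definition dense_embedding ::
    "('y::real_normed_vector \<Rightarrow> 'x::real_normed_vector) \<Rightarrow> bool" where
  "dense_embedding J \<longleftrightarrow>
     bounded_linear J \<and> inj J \<and> closure (range J) = UNIV \<and> (\<forall>y. norm (J y) \<le> norm y)"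

definition cond_K1 :: "('y::real_inner \<Rightarrow> 'x::real_inner) \<Rightarrow> ('y \<Rightarrow> 'x set) \<Rightarrow> ('y \<Rightarrow> 'x \<Rightarrow> 'x) \<Rightarrow>
    (real \<Rightarrow> real) \<Rightarrow> bool" where
  "cond_K1 J DA A MA \<longleftrightarrow>
     (\<forall>y. {l. Re l < 0} \<subseteq> resolvent_set (DA y) (A y)) \<and>
     (\<forall>y. \<forall>w\<in>DA y. inner w (A y w) \<ge> 0) \<and>
     (\<forall>y. range J \<subseteq> DA y) \<and>
     (\<forall>R>0. \<forall>y w. norm y \<le> R \<longrightarrow> norm (A y (J w)) \<le> MA R * norm w)"

text \<open>
  The operator \<open>S T S\<^sup>-\<^sup>1\<close> on \<open>X\<close>, with its maximal domain: \<open>S\<^sup>-\<^sup>1\<close> maps into \<open>Y\<close>, and \<open>S\<close> can only be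
  applied to \<open>T S\<^sup>-\<^sup>1 v\<close> if this lies in \<open>Y\<close>.
\<close>

definition conj_domain :: "('y \<Rightarrow> 'x) \<Rightarrow> ('y \<Rightarrow> 'x) \<Rightarrow> 'x set \<Rightarrow> ('x \<Rightarrow> 'x) \<Rightarrow> 'x set" where
  "conj_domain J S D T = {S w |w. J w \<in> D \<and> T (J w) \<in> range J}"

definition conj_operator :: "('y \<Rightarrow> 'x) \<Rightarrow> ('y \<Rightarrow> 'x) \<Rightarrow> ('x \<Rightarrow> 'x) \<Rightarrow> 'x \<Rightarrow> 'x" where
  "conj_operator J S T v = S (inv J (T (J (inv S v))))"

text \<open>
  Surjectivity of the isometry \<open>S\<close> is not listed: it follows from self-adjointness and
  \<open>norm (S y) = norm y \<ge> norm (J y)\<close>.  As \<open>B y\<close> is defined on all of \<open>X\<close>, the domain of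
  \<open>A y + B y\<close> is that of \<open>A y\<close>.
\<close>

definition cond_K2 :: "('y::real_inner \<Rightarrow> 'x::real_inner) \<Rightarrow> ('y \<Rightarrow> 'x set) \<Rightarrow> ('y \<Rightarrow> 'x \<Rightarrow> 'x) \<Rightarrow>
    ('y \<Rightarrow> 'x \<Rightarrow> 'x) \<Rightarrow> ('y \<Rightarrow> 'x) \<Rightarrow> (real \<Rightarrow> real) \<Rightarrow> bool" where
  "cond_K2 J DA A B S MB \<longleftrightarrow>
     linear S \<and> (\<forall>y. norm (S y) = norm y) \<and>
     self_adjoint_operator (range J) (\<lambda>v. S (inv J v)) \<and>
     (\<forall>y. linear (B y)) \<and>
     (\<forall>y. conj_domain J S (DA y) (A y) = DA y \<and>
          (\<forall>v\<in>DA y. conj_operator J S (A y) v = A y v + B y v)) \<and>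
     (\<forall>R>0. \<forall>y v. norm y \<le> R \<longrightarrow> norm (B y v) \<le> MB R * norm v)"

definition cond_K3 :: "('y::real_inner \<Rightarrow> 'x::real_inner) \<Rightarrow> ('y \<Rightarrow> 'x \<Rightarrow> 'x) \<Rightarrow>
    ('y \<Rightarrow> 'x \<Rightarrow> 'x) \<Rightarrow> (real \<Rightarrow> real) \<Rightarrow> (real \<Rightarrow> real) \<Rightarrow> bool" where
  "cond_K3 J A B LA LB \<longleftrightarrow>
     (\<forall>R>0. \<forall>y y'. norm y \<le> R \<and> norm y' \<le> R \<longrightarrow>
        (\<forall>w. norm (A y (J w) - A y' (J w)) \<le> LA R * norm (J y - J y') * norm w) \<and>
        (\<forall>v. norm (B y v - B y' v) \<le> LB R * norm (y - y') * norm v))"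

section \<open>Regularity\<close>

text \<open>\<open>d j\<close> is the \<open>j\<close>-th derivative of \<open>f\<close>, one-sided at the end points of the interval \<open>I\<close>.\<close>

definition C_k_on :: "nat \<Rightarrow> real set \<Rightarrow> (real \<Rightarrow> 'a::real_normed_vector) \<Rightarrow> bool" where
  "C_k_on k I f \<longleftrightarrow>
     (\<exists>d :: nat \<Rightarrow> real \<Rightarrow> 'a.
        (\<forall>t\<in>I. d 0 t = f t) \<and>
        (\<forall>j<k. \<forall>t\<in>I. (d j has_vector_derivative d (Suc j) t) (at t within I)) \<and>
        (\<forall>j\<le>k. continuous_on I (d j)))"

definition solution_on :: "('y \<Rightarrow> 'x::real_normed_vector) \<Rightarrow> ('y \<Rightarrow> 'x \<Rightarrow> 'x) \<Rightarrow> real set \<Rightarrow>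
    (real \<Rightarrow> 'y) \<Rightarrow> bool" where
  "solution_on J A I u \<longleftrightarrow>
     (\<forall>t\<in>I. ((\<lambda>s. J (u s)) has_vector_derivative - A (u t) (J (u t))) (at t within I))"

section \<open>Runge--Kutta methods\<close>

text \<open>An \<open>m\<close>-stage method has its stages indexed by a finite type with \<open>m\<close> elements.\<close>

definition rk_node :: "real^'m^'m \<Rightarrow> 'm::finite \<Rightarrow> real" where
  "rk_node a i = (\<Sum>j\<in>UNIV. a $ i $ j)"

text \<open>
  The values \<open>u (t\<^sub>n + c\<^sub>i \<tau>)\<close> exist only where \<open>t\<^sub>n + c\<^sub>i \<tau>\<close> lies in the interval of the solution.
  A method of stage order \<open>q \<ge> 2\<close> with a node outside \<open>[0, 1]\<close> uses \<open>A\<close> beyond the end points of the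
  trajectory, where \<open>A\<close> is merely Lipschitz; this costs an error of size \<open>\<tau>\<^sup>2\<close>, which exceeds
  \<open>C \<tau> ^ (q + 1)\<close>.  Therefore the error bound is to be stated with nodes in \<open>[0, 1]\<close> if \<open>q \<ge> 2\<close>.
\<close>

definition stage_order :: "real^'m^'m \<Rightarrow> nat \<Rightarrow> bool" where
  "stage_order a q \<longleftrightarrow>
     (\<forall>i. \<forall>k\<in>{1..q}. (\<Sum>j\<in>UNIV. a $ i $ j * rk_node a j ^ (k - 1)) = rk_node a i ^ k / real k)"

definition quadrature_order_ge :: "real^'m^'m \<Rightarrow> real^'m \<Rightarrow> nat \<Rightarrow> bool" where
  "quadrature_order_ge a b p \<longleftrightarrow>
     (\<forall>k\<in>{1..p}. (\<Sum>j\<in>UNIV. b $ j * rk_node a j ^ (k - 1)) = 1 / real k)"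

definition diag_matrix :: "real^'m \<Rightarrow> real^'m^'m" where
  "diag_matrix d = (\<chi> i j. if i = j then d $ i else 0)"

definition coercive :: "real^'m^'m \<Rightarrow> bool" where
  "coercive a \<longleftrightarrow> invertible a \<and>
     (\<exists>d \<alpha>. (\<forall>i. d $ i > 0) \<and> \<alpha> > 0 \<and>
        (\<forall>v. inner v ((diag_matrix d ** matrix_inv a) *v v) \<ge> \<alpha> * inner v (diag_matrix d *v v)))"

definition algebraically_stable :: "real^'m^'m \<Rightarrow> real^'m \<Rightarrow> bool" where
  "algebraically_stable a b \<longleftrightarrow> (\<forall>i. b $ i > 0) \<and>
     (\<forall>v. inner v ((\<chi> i j. b $ i * a $ i $ j + b $ j * a $ j $ i - b $ i * b $ j) *v v) \<ge> 0)"

definition stage_dot :: "('y \<Rightarrow> 'x::real_vector) \<Rightarrow> ('y \<Rightarrow> 'x \<Rightarrow> 'x) \<Rightarrow> 'y \<Rightarrow> 'x" where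
  "stage_dot J A y = - A y (J y)"

text \<open>The stages \<open>U i\<close> lie in \<open>Y\<close>, but the equations are equations in \<open>X\<close>.\<close>

definition rk_stages :: "('y::real_normed_vector \<Rightarrow> 'x::real_normed_vector) \<Rightarrow> ('y \<Rightarrow> 'x \<Rightarrow> 'x) \<Rightarrow>
    real^'m^'m \<Rightarrow> real \<Rightarrow> real \<Rightarrow> 'y \<Rightarrow> ('m::finite \<Rightarrow> 'y) \<Rightarrow> bool" where
  "rk_stages J A a Cst \<tau> w U \<longleftrightarrow>
     (\<forall>i. J (U i) = J w + \<tau> *\<^sub>R (\<Sum>j\<in>UNIV. a $ i $ j *\<^sub>R stage_dot J A (U j))) \<and>
     (\<forall>i. norm (J (U i)) \<le> Cst * norm (J w) \<and> norm (U i) \<le> Cst * norm w)"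

text \<open>
  \<open>rk_stages\<close> contains the stage bounds, and \<open>stage_constant\<close> is the property that singles out the
  numerical solution: for small \<open>\<tau>\<close> there is exactly one family of stages within the bounds.
\<close>

definition stage_constant :: "('y::real_normed_vector \<Rightarrow> 'x::real_normed_vector) \<Rightarrow>
    ('y \<Rightarrow> 'x \<Rightarrow> 'x) \<Rightarrow> real^'m^'m \<Rightarrow> real \<Rightarrow> bool" where
  "stage_constant J A a Cst \<longleftrightarrow>
     (\<forall>\<rho>>0. \<exists>\<tau>\<^sub>0>0. \<forall>\<tau>. 0 < \<tau> \<and> \<tau> \<le> \<tau>\<^sub>0 \<longrightarrow>
        (\<forall>w. norm w \<le> \<rho> \<longrightarrow> (\<exists>!U. rk_stages J A a Cst \<tau> w U)))"

text \<open>\<open>un\<close> is the numerical solution, with stages \<open>U n\<close> in the step from \<open>un n\<close> to \<open>un (n + 1)\<close>.\<close>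

definition rk_solution :: "('y::real_normed_vector \<Rightarrow> 'x::real_normed_vector) \<Rightarrow>
    ('y \<Rightarrow> 'x \<Rightarrow> 'x) \<Rightarrow> real^'m^'m \<Rightarrow> real^'m \<Rightarrow> real \<Rightarrow> real \<Rightarrow> real \<Rightarrow> 'y \<Rightarrow>
    (nat \<Rightarrow> 'y) \<Rightarrow> (nat \<Rightarrow> 'm::finite \<Rightarrow> 'y) \<Rightarrow> bool" where
  "rk_solution J A a b Cst T \<tau> u\<^sub>0 un U \<longleftrightarrow>
     un 0 = u\<^sub>0 \<and>
     (\<forall>n. real (Suc n) * \<tau> \<le> T \<longrightarrow>
        rk_stages J A a Cst \<tau> (un n) (U n) \<and>
        J (un (Suc n)) = J (un n) + \<tau> *\<^sub>R (\<Sum>i\<in>UNIV. b $ i *\<^sub>R stage_dot J A (U n i)))"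

end

theory Submission
  imports Defs
begin

text \<open>
  Write \<open>e\<^sub>n = u\<^sub>n - u(t\<^sub>n)\<close>.  The proof is an energy estimate for \<open>e\<^sub>n\<close> in the norm of \<open>Y\<close>, in which the
  exact solution is treated as a perturbed Runge--Kutta solution: with comparison stages \<open>Z\<^sub>i\<close>, defects
  \<open>d\<^sub>i\<close> in the stage equations, residuals \<open>r\<^sub>i\<close> in the differential equation and a quadrature defect, the
  stage errors \<open>E\<^sub>i = U\<^sub>i - Z\<^sub>i\<close> satisfy \<open>E\<^sub>i = e\<^sub>n + \<tau> \<Sum>\<^sub>j a\<^sub>i\<^sub>j F\<^sub>j - d\<^sub>i\<close>, where \<open>F\<^sub>j\<close> is the difference of
  the stage derivatives.

  Two algebraic facts about the method enter.  Algebraic stability bounds the increase of \<open>\<parallel>e\<^sub>n\<parallel>\<^sup>2\<close>, up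
  to the quadrature defect, by \<open>2\<tau> \<Sum>\<^sub>i b\<^sub>i (E\<^sub>i + d\<^sub>i, F\<^sub>i)\<close> (\<open>algebraic_stability_estimate\<close>), and coercivity bounds
  the \<open>E\<^sub>i\<close> by \<open>e\<^sub>n\<close> and the perturbations (\<open>coercive_stage_bound\<close>).  Both carry a statement about
  real quadratic forms over to vectors of a Hilbert space.

  The operators enter through the two inner products.  Since \<open>S A(y) S\<^sup>-\<^sup>1 = A(y) + B(y)\<close>, the operator \<open>A(y)\<close> is
  accretive in \<open>Y\<close> up to a bounded term, and \<open>(A(y) - A(z)) w\<close> is Lipschitz in \<open>Y\<close> if \<open>S w \<in> Y\<close>;
  hence \<open>(E\<^sub>i, F\<^sub>i)\<close> is at most a multiple of \<open>\<parallel>E\<^sub>i\<parallel>\<^sup>2\<close>, up to the residual.  The term \<open>(d\<^sub>i, F\<^sub>i)\<close> looks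
  dangerous because \<open>F\<^sub>i\<close> is not bounded in \<open>Y\<close> by \<open>E\<^sub>i\<close>.  But \<open>S d\<^sub>i\<close> lies in \<open>Y\<close>, by the regularity of
  \<open>S u\<close>, so the symmetry of \<open>S\<close> moves one factor \<open>S\<close> from \<open>F\<^sub>i\<close> to \<open>S d\<^sub>i\<close>, and in \<open>X\<close> the difference \<open>F\<^sub>i\<close>
  is bounded by \<open>\<parallel>E\<^sub>i\<parallel>\<close> and the residual.  This gives the one-step estimate \<open>rk_step_stability\<close>.

  If all \<open>t\<^sub>n + c\<^sub>i \<tau>\<close> lie in \<open>[0, T]\<close>, the comparison stages are \<open>u(t\<^sub>n + c\<^sub>i \<tau>)\<close>; the order conditions
  make the stage defects \<open>O(\<tau>\<^sup>q\<^sup>+\<^sup>1)\<close> and the quadrature defect \<open>O(\<tau>\<^sup>q\<^sup>+\<^sup>2)\<close>.  Otherwise \<open>q \<le> 1\<close>, and the tangent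
  \<open>u(t\<^sub>n) + c\<^sub>i \<tau> u'(t\<^sub>n)\<close> is used: it satisfies the stage equations exactly, with residuals \<open>O(\<tau>)\<close>.
  Such a step may multiply the error by a constant and add \<open>O(\<tau>\<^sup>2)\<close>, which is harmless since only a bounded number of
  them occur, close to the end points of \<open>[0, T]\<close>.  A discrete Gronwall argument then gives
  the bound; it is run together with the induction which shows that the \<open>u\<^sub>n\<close> stay in a
  fixed ball of \<open>Y\<close>, as the constants of the operators depend on that ball.
\<close>

section \<open>Quadratic forms on inner products and stability of the method\<close>

lemma orthogonal_expansion:
  fixes C :: "'v::real_inner set"
  assumes "finite C" "pairwise orthogonal C" "x \<in> span C"
  shows "inner x y = (\<Sum>e\<in>C. inner x e * inner y e / inner e e)"
proof -
  obtain f where f: "x = (\<Sum>e\<in>C. f e *\<^sub>R e)"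
    using assms(3) unfolding span_finite[OF assms(1)] by auto
  have fe: "inner x e = f e * inner e e" if "e \<in> C" for e
  proof -
    have "inner x e = (\<Sum>g\<in>C. if g = e then f e * inner e e else 0)"
      unfolding f inner_sum_left
    proof (rule sum.cong[OF refl])
      fix g assume g: "g \<in> C"
      show "inner (f g *\<^sub>R g) e = (if g = e then f e * inner e e else 0)"
        using assms(2) g that by (auto simp: pairwise_def orthogonal_def)
    qed
    then show ?thesis
      using assms(1) that by simp
  qed
  have "inner x y = (\<Sum>e\<in>C. f e * inner y e)"
    unfolding f inner_sum_left by (simp add: inner_commute)
  also have "\<dots> = (\<Sum>e\<in>C. inner x e * inner y e / inner e e)"
    by (rule sum.cong) (auto simp: fe)
  finally show ?thesis .
qed

text \<open>
  In an orthogonal basis of the span of the \<open>x i\<close> the form splits into a sum, with nonnegative weights, of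
  values of the real form at the coordinate vectors.  So an inequality between quadratic
  forms of the coefficients of the method holds for Hilbert space valued stages as well.
\<close>

lemma nonneg_form_on_inner_products:
  fixes M :: "real^'m^'m" and x :: "'m::finite \<Rightarrow> 'v::real_inner"
  assumes "\<And>v. inner v (M *v v) \<ge> 0"
  shows "(\<Sum>i\<in>UNIV. \<Sum>j\<in>UNIV. M $ i $ j * inner (x i) (x j)) \<ge> 0"
proof -
  obtain C where C: "finite C" "span C = span (range x)" "pairwise orthogonal C"
    using basis_orthogonal[of "range x"] by auto
  have expand: "inner (x i) (x j) = (\<Sum>e\<in>C. inner (x i) e * inner (x j) e / inner e e)" for i j
    using C by (intro orthogonal_expansion) (auto intro: span_base)
  have "(\<Sum>i\<in>UNIV. \<Sum>j\<in>UNIV. M $ i $ j * inner (x i) (x j))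
      = (\<Sum>i\<in>UNIV. \<Sum>j\<in>UNIV. \<Sum>e\<in>C. M $ i $ j * inner (x i) e * inner (x j) e / inner e e)"
    by (simp add: expand sum_distrib_left mult_ac)
  also have "\<dots> = (\<Sum>i\<in>UNIV. \<Sum>e\<in>C. \<Sum>j\<in>UNIV. M $ i $ j * inner (x i) e * inner (x j) e / inner e e)"
    by (intro sum.cong refl sum.swap)
  also have "\<dots> = (\<Sum>e\<in>C. \<Sum>i\<in>UNIV. \<Sum>j\<in>UNIV. M $ i $ j * inner (x i) e * inner (x j) e / inner e e)"
    by (rule sum.swap)
  also have "\<dots> = (\<Sum>e\<in>C. inner (\<chi> i. inner (x i) e) (M *v (\<chi> i. inner (x i) e)) / inner e e)"
    by (simp add: inner_vec_def matrix_vector_mult_def sum_distrib_left sum_divide_distrib mult_ac)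
  also have "\<dots> \<ge> 0"
    by (intro sum_nonneg divide_nonneg_nonneg assms) auto
  finally show ?thesis .
qed

text \<open>
  Expanding the square and substituting \<open>e = E i - \<tau> *\<^sub>R (\<Sum>j. a $ i $ j *\<^sub>R F j) + d i\<close> into the mixed terms leaves \<open>- \<tau>\<^sup>2\<close>
  times the form with the matrix \<open>b\<^sub>i a\<^sub>i\<^sub>j + b\<^sub>j a\<^sub>j\<^sub>i - b\<^sub>i b\<^sub>j\<close> in the \<open>F i\<close>, which has the right sign.
\<close>

lemma algebraic_stability_estimate:
  fixes a :: "real^'m^'m" and b :: "real^'m" and E F d :: "'m::finite \<Rightarrow> 'v::real_inner"
  assumes stab: "algebraically_stable a b"
    and E: "\<And>i. E i = e + \<tau> *\<^sub>R (\<Sum>j\<in>UNIV. a $ i $ j *\<^sub>R F j) - d i"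
  shows "(norm (e + \<tau> *\<^sub>R (\<Sum>i\<in>UNIV. b $ i *\<^sub>R F i)))\<^sup>2
    \<le> (norm e)\<^sup>2 + 2 * \<tau> * (\<Sum>i\<in>UNIV. b $ i * inner (E i + d i) (F i))"
proof -
  let ?P = "\<Sum>i\<in>UNIV. \<Sum>j\<in>UNIV. b $ i * a $ i $ j * inner (F i) (F j)"
  let ?b = "\<Sum>i\<in>UNIV. b $ i *\<^sub>R F i"
  have "0 \<le> (\<Sum>i\<in>UNIV. \<Sum>j\<in>UNIV. (\<chi> i j. b $ i * a $ i $ j + b $ j * a $ j $ i - b $ i * b $ j) $ i $ j
      * inner (F i) (F j))"
    using stab unfolding algebraically_stable_def by (intro nonneg_form_on_inner_products) blast
  also have "\<dots> = ?P + (\<Sum>i\<in>UNIV. \<Sum>j\<in>UNIV. b $ j * a $ j $ i * inner (F i) (F j))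
      - (\<Sum>i\<in>UNIV. \<Sum>j\<in>UNIV. b $ i * b $ j * inner (F i) (F j))"
    by (simp add: algebra_simps sum.distrib sum_subtractf)
  also have "(\<Sum>i\<in>UNIV. \<Sum>j\<in>UNIV. b $ j * a $ j $ i * inner (F i) (F j)) = ?P"
    by (subst sum.swap) (simp add: inner_commute)
  also have "(\<Sum>i\<in>UNIV. \<Sum>j\<in>UNIV. b $ i * b $ j * inner (F i) (F j)) = inner ?b ?b"
    by (simp add: inner_sum_left inner_sum_right mult_ac sum_distrib_left inner_commute)
  finally have form: "inner ?b ?b \<le> 2 * ?P"
    by simp
  have "(\<Sum>i\<in>UNIV. b $ i * inner (E i + d i) (F i)) = inner e ?b + \<tau> * ?P"
    unfolding E
    by (simp add: inner_add_left inner_sum_left inner_sum_right algebra_simps sum.distrib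
        sum_distrib_left inner_commute)
  then have "2 * \<tau> * (\<Sum>i\<in>UNIV. b $ i * inner (E i + d i) (F i)) = 2 * \<tau> * inner e ?b + \<tau>\<^sup>2 * (2 * ?P)"
    by (simp add: algebra_simps power2_eq_square)
  moreover have "(norm (e + \<tau> *\<^sub>R ?b))\<^sup>2 = (norm e)\<^sup>2 + 2 * \<tau> * inner e ?b + \<tau>\<^sup>2 * inner ?b ?b"
    unfolding power2_norm_eq_inner
    by (simp add: inner_add_left inner_add_right inner_commute power2_eq_square algebra_simps)
  moreover have "\<tau>\<^sup>2 * inner ?b ?b \<le> \<tau>\<^sup>2 * (2 * ?P)"
    using form by (intro mult_left_mono) auto
  ultimately show ?thesis by linarith
qed

lemma coercive_form_on_inner_products:
  fixes a :: "real^'m::finite^'m"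
  assumes "coercive a"
  obtains \<delta> :: "real^'m" and \<alpha> where "\<And>i. \<delta> $ i > 0" "\<alpha> > 0"
    "\<And>x :: 'm \<Rightarrow> 'v::real_inner. \<alpha> * (\<Sum>i\<in>UNIV. \<delta> $ i * (norm (x i))\<^sup>2)
       \<le> (\<Sum>i\<in>UNIV. \<Sum>j\<in>UNIV. \<delta> $ i * matrix_inv a $ i $ j * inner (x i) (x j))"
proof -
  obtain \<delta> \<alpha> where *: "\<And>i. \<delta> $ i > 0" "\<alpha> > 0"
    and coer: "\<And>v. inner v ((diag_matrix \<delta> ** matrix_inv a) *v v) \<ge> \<alpha> * inner v (diag_matrix \<delta> *v v)"
    using assms unfolding coercive_def by blast
  let ?M = "diag_matrix \<delta> ** matrix_inv a - \<alpha> *\<^sub>R diag_matrix \<delta>"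
  have entry: "(diag_matrix \<delta> ** matrix_inv a) $ i $ j = \<delta> $ i * matrix_inv a $ i $ j" for i j
    by (simp add: diag_matrix_def matrix_matrix_mult_def if_distrib[of "\<lambda>x. x * _"] cong: if_cong)
  have form: "(\<Sum>i\<in>UNIV. \<Sum>j\<in>UNIV. ?M $ i $ j * inner (x i) (x j)) \<ge> 0" for x :: "'m \<Rightarrow> 'v"
    using coer by (intro nonneg_form_on_inner_products)
      (simp add: matrix_vector_mult_diff_rdistrib inner_diff_right scaleR_matrix_vector_assoc[symmetric])
  have "\<alpha> * (\<Sum>i\<in>UNIV. \<delta> $ i * (norm (x i))\<^sup>2)
       \<le> (\<Sum>i\<in>UNIV. \<Sum>j\<in>UNIV. \<delta> $ i * matrix_inv a $ i $ j * inner (x i) (x j))" for x :: "'m \<Rightarrow> 'v"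
  proof -
    have "(\<Sum>j\<in>UNIV. ?M $ i $ j * inner (x i) (x j))
        = (\<Sum>j\<in>UNIV. \<delta> $ i * matrix_inv a $ i $ j * inner (x i) (x j)) - \<alpha> * (\<delta> $ i * (norm (x i))\<^sup>2)" for i
    proof -
      have "(\<Sum>j\<in>UNIV. \<alpha> * diag_matrix \<delta> $ i $ j * inner (x i) (x j))
          = (\<Sum>j\<in>UNIV. if j = i then \<alpha> * (\<delta> $ i * (norm (x i))\<^sup>2) else 0)"
        by (intro sum.cong) (auto simp: diag_matrix_def power2_norm_eq_inner)
      then show ?thesis
        by (simp add: entry left_diff_distrib sum_subtractf)
    qed
    then show ?thesis
      using form[of x] by (simp add: sum_subtractf sum_distrib_left)
  qed
  then show thesis
    by (rule that[OF *])
qed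

text \<open>
  Multiplication of the stage equations by the inverse of \<open>a\<close> isolates \<open>\<tau> *\<^sub>R F i\<close>; testing with \<open>\<delta> $ i *\<^sub>R E i\<close>
  then gives a coercive left-hand side.  The one-sided bound on \<open>inner (E i) (F i)\<close> is all that is
  used of the unbounded operators, and for \<open>\<tau> * K \<le> \<kappa>\<close> it is absorbed.  The bounds \<open>\<kappa>\<close> and \<open>C\<close> depend on
  the method only.
\<close>

lemma coercive_stage_bound:
  fixes a :: "real^'m::finite^'m"
  assumes "coercive a"
  shows "\<exists>\<kappa>>0. \<exists>C\<ge>1. \<forall>(E :: 'm \<Rightarrow> 'v::real_inner) F d e \<tau> K \<beta> \<epsilon>.
      (\<forall>i. E i = e + \<tau> *\<^sub>R (\<Sum>j\<in>UNIV. a $ i $ j *\<^sub>R F j) - d i) \<and> (\<forall>i. norm (d i) \<le> \<epsilon>) \<and>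
      (\<forall>i. inner (E i) (F i) \<le> K * (norm (E i))\<^sup>2 + \<beta> * norm (E i)) \<and>
      0 \<le> \<tau> \<and> 0 \<le> \<beta> \<and> \<tau> * K \<le> \<kappa> \<longrightarrow> (\<forall>i. norm (E i) \<le> C * (norm e + \<epsilon> + \<tau> * \<beta>))"
proof -
  obtain \<delta> :: "real^'m" and \<alpha> where \<delta>: "\<And>i. \<delta> $ i > 0" and \<alpha>: "\<alpha> > 0"
    and form: "\<And>x :: 'm \<Rightarrow> 'v. \<alpha> * (\<Sum>i\<in>UNIV. \<delta> $ i * (norm (x i))\<^sup>2)
       \<le> (\<Sum>i\<in>UNIV. \<Sum>j\<in>UNIV. \<delta> $ i * matrix_inv a $ i $ j * inner (x i) (x j))"
    using coercive_form_on_inner_products[OF assms] by blast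
  let ?w = "matrix_inv a"
  have inv: "?w ** a = mat 1"
    using assms unfolding coercive_def invertible_def matrix_inv_def by (metis (mono_tags, lifting) someI_ex)
  define \<delta>0 where "\<delta>0 = Min (range (\<lambda>i. \<delta> $ i))"
  have \<delta>0: "\<delta>0 > 0" "\<And>i. \<delta>0 \<le> \<delta> $ i"
    using \<delta> by (auto simp: \<delta>0_def)
  define W where "W = (\<Sum>i\<in>UNIV. \<Sum>j\<in>UNIV. \<bar>?w $ i $ j\<bar>)"
  have W: "(\<Sum>j\<in>UNIV. \<bar>?w $ i $ j\<bar>) \<le> W" for i
    unfolding W_def by (rule member_le_sum[of i UNIV "\<lambda>i. \<Sum>j\<in>UNIV. \<bar>?w $ i $ j\<bar>"]) (auto intro: sum_nonneg)
  have W0: "W \<ge> 0"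
    unfolding W_def by (intro sum_nonneg) auto
  define \<Delta> where "\<Delta> = (\<Sum>i\<in>UNIV. \<delta> $ i)"
  have \<Delta>: "\<Delta> \<ge> 0"
    unfolding \<Delta>_def using \<delta> by (intro sum_nonneg) (simp add: less_imp_le)
  define C where "C = 2 * \<Delta> * (W + 1) / (\<alpha> * \<delta>0) + 1"
  have C: "C \<ge> 1"
    unfolding C_def using \<Delta> W0 \<alpha> \<delta>0 by simp
  have bound: "norm (E i) \<le> C * (norm e + \<epsilon> + \<tau> * \<beta>)"
    if E: "\<And>i. E i = e + \<tau> *\<^sub>R (\<Sum>j\<in>UNIV. a $ i $ j *\<^sub>R F j) - d i" and d: "\<And>i. norm (d i) \<le> \<epsilon>"
      and F: "\<And>i. inner (E i) (F i) \<le> K * (norm (E i))\<^sup>2 + \<beta> * norm (E i)"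
      and pos: "0 \<le> \<tau>" "0 \<le> \<beta>" and \<tau>: "\<tau> * K \<le> \<alpha> / 2"
    for E F d :: "'m \<Rightarrow> 'v" and e \<tau> K \<beta> \<epsilon> i
  proof -
    have \<epsilon>: "\<epsilon> \<ge> 0"
      using d norm_ge_zero order_trans by blast
    define H where "H = norm e + \<epsilon>"
    have H: "H \<ge> 0" using \<epsilon> by (simp add: H_def)
    have wE: "(\<Sum>j\<in>UNIV. ?w $ i $ j *\<^sub>R E j) = \<tau> *\<^sub>R F i + (\<Sum>j\<in>UNIV. ?w $ i $ j *\<^sub>R (e - d j))" for i
    proof -
      have "(\<Sum>j\<in>UNIV. ?w $ i $ j *\<^sub>R (\<Sum>k\<in>UNIV. a $ j $ k *\<^sub>R F k))
          = (\<Sum>k\<in>UNIV. (?w ** a) $ i $ k *\<^sub>R F k)"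
        unfolding matrix_matrix_mult_def
        by (simp add: scaleR_sum_right scaleR_sum_left) (rule sum.swap)
      also have "\<dots> = (\<Sum>k\<in>UNIV. if k = i then F i else 0)"
        unfolding inv by (intro sum.cong) (auto simp: mat_def)
      finally have *: "(\<Sum>j\<in>UNIV. ?w $ i $ j *\<^sub>R (\<Sum>k\<in>UNIV. a $ j $ k *\<^sub>R F k)) = F i"
        by simp
      have "(\<Sum>j\<in>UNIV. ?w $ i $ j *\<^sub>R E j)
          = (\<Sum>j\<in>UNIV. \<tau> *\<^sub>R (?w $ i $ j *\<^sub>R (\<Sum>k\<in>UNIV. a $ j $ k *\<^sub>R F k)) + ?w $ i $ j *\<^sub>R (e - d j))"
        unfolding E by (intro sum.cong refl) (simp add: algebra_simps)
      also have "\<dots> = \<tau> *\<^sub>R (\<Sum>j\<in>UNIV. ?w $ i $ j *\<^sub>R (\<Sum>k\<in>UNIV. a $ j $ k *\<^sub>R F k))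
          + (\<Sum>j\<in>UNIV. ?w $ i $ j *\<^sub>R (e - d j))"
        unfolding sum.distrib scaleR_right.sum ..
      finally show ?thesis
        unfolding * .
    qed
    have summand: "inner (E i) (\<Sum>j\<in>UNIV. ?w $ i $ j *\<^sub>R E j)
        \<le> \<alpha> / 2 * (norm (E i))\<^sup>2 + (\<tau> * \<beta> + W * H) * norm (E i)" for i
    proof -
      have "norm (\<Sum>j\<in>UNIV. ?w $ i $ j *\<^sub>R (e - d j)) \<le> (\<Sum>j\<in>UNIV. \<bar>?w $ i $ j\<bar> * H)"
      proof (rule sum_norm_le)
        fix j
        have "norm (e - d j) \<le> H"
          using norm_triangle_ineq4[of e "d j"] d[of j] by (simp add: H_def)
        then show "norm (?w $ i $ j *\<^sub>R (e - d j)) \<le> \<bar>?w $ i $ j\<bar> * H"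
          by (simp add: mult_left_mono)
      qed
      also have "\<dots> \<le> W * H"
        unfolding sum_distrib_right[symmetric] using W H by (rule mult_right_mono)
      finally have "norm (E i) * norm (\<Sum>j\<in>UNIV. ?w $ i $ j *\<^sub>R (e - d j)) \<le> norm (E i) * (W * H)"
        by (rule mult_left_mono) simp
      then have 1: "inner (E i) (\<Sum>j\<in>UNIV. ?w $ i $ j *\<^sub>R (e - d j)) \<le> norm (E i) * (W * H)"
        using norm_cauchy_schwarz order_trans by blast
      have "\<tau> * inner (E i) (F i) \<le> \<tau> * (K * (norm (E i))\<^sup>2 + \<beta> * norm (E i))"
        using F pos by (intro mult_left_mono) auto
      moreover have "(\<tau> * K) * (norm (E i))\<^sup>2 \<le> \<alpha> / 2 * (norm (E i))\<^sup>2"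
        using \<tau> by (intro mult_right_mono) auto
      ultimately have "\<tau> * inner (E i) (F i) \<le> \<alpha> / 2 * (norm (E i))\<^sup>2 + \<tau> * \<beta> * norm (E i)"
        by (simp add: algebra_simps)
      then show ?thesis
        unfolding wE inner_add_right using 1 by (simp add: algebra_simps)
    qed
    have "\<alpha> * (\<Sum>i\<in>UNIV. \<delta> $ i * (norm (E i))\<^sup>2) \<le> (\<Sum>i\<in>UNIV. \<delta> $ i * inner (E i) (\<Sum>j\<in>UNIV. ?w $ i $ j *\<^sub>R E j))"
      using form[of E] by (simp add: inner_sum_right sum_distrib_left mult_ac)
    also have "\<dots> \<le> (\<Sum>i\<in>UNIV. \<delta> $ i * (\<alpha> / 2 * (norm (E i))\<^sup>2 + (\<tau> * \<beta> + W * H) * norm (E i)))"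
      using summand \<delta> by (intro sum_mono mult_left_mono) (auto simp: less_imp_le)
    also have "\<dots> = \<alpha> / 2 * (\<Sum>i\<in>UNIV. \<delta> $ i * (norm (E i))\<^sup>2) + (\<Sum>i\<in>UNIV. \<delta> $ i * norm (E i)) * (\<tau> * \<beta> + W * H)"
      by (simp add: algebra_simps sum.distrib sum_distrib_left)
    finally have main: "\<alpha> / 2 * (\<Sum>i\<in>UNIV. \<delta> $ i * (norm (E i))\<^sup>2) \<le> (\<Sum>i\<in>UNIV. \<delta> $ i * norm (E i)) * (\<tau> * \<beta> + W * H)"
      by simp
    obtain k where k: "\<And>i. norm (E i) \<le> norm (E k)"
    proof -
      have "Max (range (\<lambda>i. norm (E i))) \<in> range (\<lambda>i. norm (E i))"
        by (intro Max_in) auto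
      then show thesis using that by (metis (mono_tags, lifting) Max_ge finite finite_imageI imageE rangeI)
    qed
    let ?G = "norm (E k)"
    have "\<delta>0 * ?G\<^sup>2 \<le> \<delta> $ k * ?G\<^sup>2"
      using \<delta>0 by (intro mult_right_mono) auto
    also have "\<dots> \<le> (\<Sum>i\<in>UNIV. \<delta> $ i * (norm (E i))\<^sup>2)"
      using \<delta> by (intro member_le_sum[of k UNIV "\<lambda>i. \<delta> $ i * (norm (E i))\<^sup>2"]) (auto simp: less_imp_le)
    finally have "\<alpha> / 2 * (\<delta>0 * ?G\<^sup>2) \<le> \<alpha> / 2 * (\<Sum>i\<in>UNIV. \<delta> $ i * (norm (E i))\<^sup>2)"
      using \<alpha> by (intro mult_left_mono) auto
    also note main
    also have "(\<Sum>i\<in>UNIV. \<delta> $ i * norm (E i)) * (\<tau> * \<beta> + W * H) \<le> \<Delta> * ?G * (\<tau> * \<beta> + W * H)"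
      unfolding \<Delta>_def sum_distrib_right[of _ _ ?G] using \<delta> pos W0 H k
      by (intro mult_right_mono sum_mono mult_left_mono add_nonneg_nonneg mult_nonneg_nonneg) (auto simp: less_imp_le)
    also have "\<dots> \<le> \<Delta> * ?G * ((W + 1) * (H + \<tau> * \<beta>))"
      using \<Delta> W0 H pos by (intro mult_left_mono mult_nonneg_nonneg) (auto simp: algebra_simps)
    finally have "?G * (\<alpha> * \<delta>0 * ?G) \<le> ?G * (2 * \<Delta> * (W + 1) * (H + \<tau> * \<beta>))"
      by (simp add: power2_eq_square algebra_simps)
    then have "\<alpha> * \<delta>0 * ?G \<le> 2 * \<Delta> * (W + 1) * (H + \<tau> * \<beta>)"
      using \<Delta> W0 H pos \<delta>0 \<alpha> by (cases "?G = 0") auto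
    then have "?G \<le> 2 * \<Delta> * (W + 1) / (\<alpha> * \<delta>0) * (H + \<tau> * \<beta>)"
      using \<alpha> \<delta>0 by (simp add: field_simps)
    also have "\<dots> \<le> C * (H + \<tau> * \<beta>)"
      unfolding C_def using H pos by (intro mult_right_mono) auto
    finally show ?thesis
      using k[of i] by (simp add: H_def)
  qed
  show ?thesis
  proof (rule exI[of _ "\<alpha> / 2"], intro exI[of _ C] conjI allI impI; (elim conjE)?)
    fix E F d :: "'m \<Rightarrow> 'v" and e \<tau> K \<beta> \<epsilon> i
    assume "\<forall>i. E i = e + \<tau> *\<^sub>R (\<Sum>j\<in>UNIV. a $ i $ j *\<^sub>R F j) - d i" "\<forall>i. norm (d i) \<le> \<epsilon>"
      "\<forall>i. inner (E i) (F i) \<le> K * (norm (E i))\<^sup>2 + \<beta> * norm (E i)"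
      "0 \<le> \<tau>" "0 \<le> \<beta>" "\<tau> * K \<le> \<alpha> / 2"
    then show "norm (E i) \<le> C * (norm e + \<epsilon> + \<tau> * \<beta>)"
      by (intro bound[where E = E and F = F and d = d and K = K]) blast+
  qed (use \<alpha> C in auto)
qed

section \<open>Taylor expansion and quadrature defects\<close>

text \<open>
  Induction over the order: the derivative of the remainder is the remainder of the derivative,
  so the mean value inequality gains one power of \<open>\<bar>x - t\<bar>\<close>.  The factor \<open>1 / fact N\<close> is
  given away.
\<close>

lemma taylor_remainder_bound:
  fixes d :: "nat \<Rightarrow> real \<Rightarrow> 'a::real_normed_vector"
  assumes "convex I" "t \<in> I" "x \<in> I"
    and "\<And>j y. j < N \<Longrightarrow> y \<in> I \<Longrightarrow> (d j has_vector_derivative d (Suc j) y) (at y within I)"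
    and "\<And>y. y \<in> I \<Longrightarrow> norm (d N y) \<le> M"
  shows "norm (d 0 x - (\<Sum>k<N. ((x - t) ^ k / fact k) *\<^sub>R d k t)) \<le> M * \<bar>x - t\<bar> ^ N"
  using assms(3-5)
proof (induction N arbitrary: d x)
  case 0
  then show ?case by simp
next
  case (Suc N)
  let ?J = "closed_segment t x"
  define g where "g y = d 0 y - (\<Sum>k<Suc N. ((y - t) ^ k / fact k) *\<^sub>R d k t)" for y
  define g' where "g' y = d (Suc 0) y - (\<Sum>k<N. ((y - t) ^ k / fact k) *\<^sub>R d (Suc k) t)" for y
  have J: "?J \<subseteq> I"
    using assms(1,2) Suc.prems(1) by (simp add: closed_segment_subset)
  have M: "M \<ge> 0"
    using Suc.prems(3)[OF assms(2)] norm_ge_zero order_trans by blast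
  have IH: "norm (g' y) \<le> M * \<bar>y - t\<bar> ^ N" if "y \<in> I" for y
    unfolding g'_def using Suc.IH[of y "\<lambda>k. d (Suc k)"] that Suc.prems by auto
  have g_eq: "g y = d 0 y - (d 0 t + (\<Sum>k<N. ((y - t) ^ Suc k / fact (Suc k)) *\<^sub>R d (Suc k) t))" for y
    unfolding g_def by (subst sum.lessThan_Suc_shift) simp
  have der: "(g has_vector_derivative g' y) (at y within ?J)" if "y \<in> ?J" for y
  proof -
    have "(d 0 has_vector_derivative d (Suc 0) y) (at y within ?J)"
      using Suc.prems(2)[of 0 y] J that by (auto intro: has_vector_derivative_within_subset)
    moreover have "((\<lambda>y. ((y - t) ^ Suc k / fact (Suc k)) *\<^sub>R d (Suc k) t) has_vector_derivative
        ((y - t) ^ k / fact k) *\<^sub>R d (Suc k) t) (at y within ?J)" for k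
    proof -
      have "((\<lambda>y. (y - t) ^ Suc k / fact (Suc k)) has_real_derivative
          (real (Suc k) * (y - t) ^ k) / fact (Suc k)) (at y within ?J)"
        by (intro derivative_eq_intros refl | simp)+
      also have "(real (Suc k) * (y - t) ^ k) / fact (Suc k) = (y - t) ^ k / fact k"
        unfolding fact_Suc by (simp del: of_nat_Suc)
      finally show ?thesis
        using has_vector_derivative_scaleR[OF _ has_vector_derivative_const] by fastforce
    qed
    ultimately have "((\<lambda>y. d 0 y - (d 0 t + (\<Sum>k<N. ((y - t) ^ Suc k / fact (Suc k)) *\<^sub>R d (Suc k) t)))
        has_vector_derivative d (Suc 0) y - (0 + (\<Sum>k<N. ((y - t) ^ k / fact k) *\<^sub>R d (Suc k) t)))
        (at y within ?J)"
      by (intro has_vector_derivative_diff has_vector_derivative_add has_vector_derivative_const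
          has_vector_derivative_sum)
    then show ?thesis
      unfolding g_eq[abs_def] g'_def by simp
  qed
  have "norm (g x - g t) \<le> M * \<bar>x - t\<bar> ^ N * norm (x - t)"
  proof (rule differentiable_bound[of ?J g "\<lambda>y h. h *\<^sub>R g' y"])
    fix y assume y: "y \<in> ?J"
    show "(g has_derivative (\<lambda>h. h *\<^sub>R g' y)) (at y within ?J)"
      using der[OF y] by (simp add: has_vector_derivative_def)
    have "\<bar>y - t\<bar> \<le> \<bar>x - t\<bar>"
      using y by (auto simp: closed_segment_eq_real_ivl split: if_splits)
    then have "\<bar>y - t\<bar> ^ N \<le> \<bar>x - t\<bar> ^ N"
      by (intro power_mono) auto
    then have "norm (g' y) \<le> M * \<bar>x - t\<bar> ^ N"
      using IH[of y] y J M by (meson mult_left_mono order_trans subsetD)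
    then show "onorm (\<lambda>h. h *\<^sub>R g' y) \<le> M * \<bar>x - t\<bar> ^ N"
      by (intro onorm_le) (simp add: mult.commute mult_left_mono)
  qed auto
  moreover have "g t = 0"
    by (simp add: g_eq)
  ultimately show ?case
    unfolding g_def by (simp add: mult.commute mult.left_commute)
qed

text \<open>
  The order conditions say that the rule with nodes \<open>c\<close> and weights \<open>w\<close> integrates polynomials of degree
  below \<open>p\<close> exactly over \<open>[0, c0]\<close>, so that the Taylor polynomials cancel.  With \<open>c0 = rk_node a i\<close> and
  row \<open>i\<close> of \<open>a\<close> as weights this bounds a stage defect, with \<open>c0 = 1\<close> and the weights \<open>b\<close> the defect of
  the step.
\<close>

lemma quadrature_defect_bound:
  fixes d :: "nat \<Rightarrow> real \<Rightarrow> 'a::real_normed_vector" and w c :: "'m::finite \<Rightarrow> real"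
  assumes "convex I"
    and der: "\<And>j y. j < Suc p \<Longrightarrow> y \<in> I \<Longrightarrow> (d j has_vector_derivative d (Suc j) y) (at y within I)"
    and M: "\<And>y. y \<in> I \<Longrightarrow> norm (d (Suc p) y) \<le> M"
    and order: "\<And>k. k \<in> {1..p} \<Longrightarrow> (\<Sum>j\<in>UNIV. w j * c j ^ (k - 1)) = c0 ^ k / real k"
    and t: "t \<in> I" "t + c0 * \<tau> \<in> I" "\<And>j. t + c j * \<tau> \<in> I" and \<tau>: "\<tau> > 0"
  shows "norm (d 0 (t + c0 * \<tau>) - d 0 t - \<tau> *\<^sub>R (\<Sum>j\<in>UNIV. w j *\<^sub>R d 1 (t + c j * \<tau>)))
    \<le> M * (\<bar>c0\<bar> ^ Suc p + (\<Sum>j\<in>UNIV. \<bar>w j\<bar> * \<bar>c j\<bar> ^ p)) * \<tau> ^ Suc p"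
proof -
  define R0 where "R0 = d 0 (t + c0 * \<tau>) - (\<Sum>k<Suc p. ((c0 * \<tau>) ^ k / fact k) *\<^sub>R d k t)"
  define R where "R j = d 1 (t + c j * \<tau>) - (\<Sum>k<p. ((c j * \<tau>) ^ k / fact k) *\<^sub>R d (Suc k) t)" for j
  have R0: "norm R0 \<le> M * \<bar>c0\<bar> ^ Suc p * \<tau> ^ Suc p"
    unfolding R0_def using taylor_remainder_bound[of I t "t + c0 * \<tau>" "Suc p" d M] assms
    by (simp add: abs_mult power_mult_distrib mult_ac)
  have R: "norm (R j) \<le> M * \<bar>c j\<bar> ^ p * \<tau> ^ p" for j
    unfolding R_def using taylor_remainder_bound[of I t "t + c j * \<tau>" p "\<lambda>k. d (Suc k)" M] assms
    by (simp add: abs_mult power_mult_distrib mult_ac)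
  have cancel: "\<tau> *\<^sub>R (\<Sum>j\<in>UNIV. w j *\<^sub>R (\<Sum>k<p. ((c j * \<tau>) ^ k / fact k) *\<^sub>R d (Suc k) t))
      = (\<Sum>k<p. ((c0 * \<tau>) ^ Suc k / fact (Suc k)) *\<^sub>R d (Suc k) t)"
  proof -
    have "\<tau> *\<^sub>R (\<Sum>j\<in>UNIV. w j *\<^sub>R (\<Sum>k<p. ((c j * \<tau>) ^ k / fact k) *\<^sub>R d (Suc k) t))
        = (\<Sum>j\<in>UNIV. \<Sum>k<p. (w j * c j ^ k * (\<tau> ^ Suc k / fact k)) *\<^sub>R d (Suc k) t)"
      by (simp add: scaleR_sum_right power_mult_distrib mult_ac)
    also have "\<dots> = (\<Sum>k<p. ((\<Sum>j\<in>UNIV. w j * c j ^ k) * (\<tau> ^ Suc k / fact k)) *\<^sub>R d (Suc k) t)"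
      by (subst sum.swap) (simp only: scaleR_sum_left sum_distrib_right)
    also have "\<dots> = (\<Sum>k<p. ((c0 * \<tau>) ^ Suc k / fact (Suc k)) *\<^sub>R d (Suc k) t)"
    proof (intro sum.cong refl)
      fix k assume "k \<in> {..<p}"
      then have "(\<Sum>j\<in>UNIV. w j * c j ^ k) = c0 ^ Suc k / real (Suc k)"
        using order[of "Suc k"] by auto
      then show "((\<Sum>j\<in>UNIV. w j * c j ^ k) * (\<tau> ^ Suc k / fact k)) *\<^sub>R d (Suc k) t
          = ((c0 * \<tau>) ^ Suc k / fact (Suc k)) *\<^sub>R d (Suc k) t"
        unfolding fact_Suc by (simp add: power_mult_distrib mult_ac del: power_Suc of_nat_Suc)
    qed
    finally show ?thesis .
  qed
  have "d 0 (t + c0 * \<tau>) = R0 + (d 0 t + (\<Sum>k<p. ((c0 * \<tau>) ^ Suc k / fact (Suc k)) *\<^sub>R d (Suc k) t))"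
    unfolding R0_def by (subst sum.lessThan_Suc_shift) simp
  moreover have "\<tau> *\<^sub>R (\<Sum>j\<in>UNIV. w j *\<^sub>R d 1 (t + c j * \<tau>)) = \<tau> *\<^sub>R (\<Sum>j\<in>UNIV. w j *\<^sub>R R j)
      + (\<Sum>k<p. ((c0 * \<tau>) ^ Suc k / fact (Suc k)) *\<^sub>R d (Suc k) t)"
    unfolding cancel[symmetric] scaleR_add_right[symmetric] sum.distrib[symmetric]
    by (simp add: R_def)
  ultimately have "norm (d 0 (t + c0 * \<tau>) - d 0 t - \<tau> *\<^sub>R (\<Sum>j\<in>UNIV. w j *\<^sub>R d 1 (t + c j * \<tau>)))
      = norm (R0 - \<tau> *\<^sub>R (\<Sum>j\<in>UNIV. w j *\<^sub>R R j))"
    by simp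
  also have "\<dots> \<le> norm R0 + \<tau> * norm (\<Sum>j\<in>UNIV. w j *\<^sub>R R j)"
    using norm_triangle_ineq4[of R0 "\<tau> *\<^sub>R (\<Sum>j\<in>UNIV. w j *\<^sub>R R j)"] \<tau> by simp
  also have "\<dots> \<le> M * \<bar>c0\<bar> ^ Suc p * \<tau> ^ Suc p + \<tau> * (\<Sum>j\<in>UNIV. \<bar>w j\<bar> * (M * \<bar>c j\<bar> ^ p * \<tau> ^ p))"
    using R0 R \<tau> by (intro add_mono mult_left_mono sum_norm_le) (auto intro: mult_left_mono)
  also have "\<dots> = M * (\<bar>c0\<bar> ^ Suc p + (\<Sum>j\<in>UNIV. \<bar>w j\<bar> * \<bar>c j\<bar> ^ p)) * \<tau> ^ Suc p"
    by (simp add: algebra_simps sum_distrib_left)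
  finally show ?thesis .
qed

section \<open>Scalar error recursions\<close>

text \<open>
  Here \<open>x\<close> and \<open>y\<close> are the errors before and after a step and \<open>e\<close> is the target accuracy
  \<open>\<tau> ^ (q + 1)\<close>.  Adding \<open>e\<^sup>2\<close> to the squared error turns the inhomogeneous recursion into a homogeneous
  one.  The scale \<open>s\<close> is \<open>\<tau>\<close> for ordinary steps and \<open>1\<close> for steps near the end points.
\<close>

lemma perturbed_square_growth:
  fixes x y p e s K L :: real
  assumes "0 \<le> s" "s \<le> 1" "0 \<le> y" "0 \<le> K"
    and p: "p\<^sup>2 \<le> x\<^sup>2 + K * s * (x + L * e)\<^sup>2" and y: "y \<le> p + L * s * e"
  shows "y\<^sup>2 + e\<^sup>2 \<le> (1 + (1 + 4 * K * (1 + L\<^sup>2) + 2 * L\<^sup>2) * s) * (x\<^sup>2 + e\<^sup>2)"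
proof -
  define z where "z = x\<^sup>2 + e\<^sup>2"
  define D where "D = 2 * K * (1 + L\<^sup>2)"
  have z: "0 \<le> z" "e\<^sup>2 \<le> z" and D: "0 \<le> D"
    using assms by (auto simp: z_def D_def)
  have "(x + L * e)\<^sup>2 \<le> 2 * (1 + L\<^sup>2) * z"
  proof -
    have "(x + L * e)\<^sup>2 + (x - L * e)\<^sup>2 = 2 * x\<^sup>2 + 2 * L\<^sup>2 * e\<^sup>2"
      by (simp add: power2_eq_square algebra_simps)
    moreover have "0 \<le> L\<^sup>2 * x\<^sup>2" "0 \<le> (x - L * e)\<^sup>2" "0 \<le> e\<^sup>2"
      by auto
    moreover have "2 * (1 + L\<^sup>2) * z = 2 * x\<^sup>2 + 2 * e\<^sup>2 + 2 * L\<^sup>2 * e\<^sup>2 + 2 * (L\<^sup>2 * x\<^sup>2)"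
      by (simp add: z_def algebra_simps)
    ultimately show ?thesis
      by linarith
  qed
  then have "K * s * (x + L * e)\<^sup>2 \<le> K * s * (2 * (1 + L\<^sup>2) * z)"
    using assms by (intro mult_left_mono) auto
  then have p2: "p\<^sup>2 + e\<^sup>2 \<le> (1 + D * s) * z"
    using p by (simp add: z_def D_def algebra_simps)
  have "y\<^sup>2 \<le> (p + L * s * e)\<^sup>2"
    using y assms by (intro power_mono) auto
  also have "(p + L * s * e)\<^sup>2 \<le> (1 + s) * p\<^sup>2 + 2 * L\<^sup>2 * s * e\<^sup>2"
  proof -
    have "0 \<le> s * (p - L * e)\<^sup>2"
      using assms by auto
    moreover have "s * (s * (L\<^sup>2 * e\<^sup>2)) \<le> 1 * (s * (L\<^sup>2 * e\<^sup>2))"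
      using assms by (intro mult_right_mono) auto
    ultimately show ?thesis
      by (simp add: power2_eq_square algebra_simps)
  qed
  finally have "y\<^sup>2 \<le> (1 + s) * p\<^sup>2 + 2 * L\<^sup>2 * s * e\<^sup>2" .
  moreover have "0 \<le> s * e\<^sup>2"
    using assms by simp
  ultimately have "y\<^sup>2 + e\<^sup>2 \<le> (1 + s) * (p\<^sup>2 + e\<^sup>2) + 2 * L\<^sup>2 * s * e\<^sup>2"
    by (simp add: algebra_simps)
  also have "\<dots> \<le> (1 + s) * ((1 + D * s) * z) + 2 * L\<^sup>2 * s * z"
    using p2 z assms by (intro add_mono mult_left_mono) auto
  also have "\<dots> \<le> (1 + (1 + 2 * D + 2 * L\<^sup>2) * s) * z"
  proof -
    have "s * (D * s * z) \<le> 1 * (D * s * z)"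
      using assms D z by (intro mult_right_mono) auto
    then show ?thesis
      by (simp add: algebra_simps)
  qed
  finally have "y\<^sup>2 + e\<^sup>2 \<le> (1 + (1 + 2 * D + 2 * L\<^sup>2) * s) * z" .
  moreover have "2 * D = 4 * K * (1 + L\<^sup>2)"
    by (simp add: D_def)
  ultimately show ?thesis
    by (simp only: z_def)
qed

lemma discrete_gronwall:
  fixes z \<gamma> :: "nat \<Rightarrow> real"
  assumes "\<And>k. k < n \<Longrightarrow> z (Suc k) \<le> (1 + \<gamma> k) * z k" "\<And>k. 0 \<le> z k" "\<And>k. 0 \<le> \<gamma> k"
  shows "z n \<le> exp (\<Sum>k<n. \<gamma> k) * z 0"
  using assms(1)
proof (induction n)
  case 0
  then show ?case by simp
next
  case (Suc n)
  have "z (Suc n) \<le> (1 + \<gamma> n) * z n"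
    using Suc.prems by simp
  also have "\<dots> \<le> exp (\<gamma> n) * (exp (\<Sum>k<n. \<gamma> k) * z 0)"
    using Suc assms(2,3) by (intro mult_mono) auto
  finally show ?case
    by (simp add: exp_add mult_ac)
qed

text \<open>
  The weight \<open>K\<close> belongs to the steps in which some \<open>t\<^sub>k + c\<^sub>i \<tau>\<close> may leave \<open>[0, T]\<close> if \<open>\<bar>c\<^sub>i\<bar> \<le> N\<close>.
  There are at most \<open>N\<close> of them at either end, whatever \<open>\<tau>\<close> is.
\<close>

lemma sum_boundary_weights_le:
  fixes \<tau> K T :: real and n N :: nat
  assumes "K \<ge> 0" "\<tau> > 0" "real n * \<tau> \<le> T"
  shows "(\<Sum>k<n. if k < N \<or> real (k + N) * \<tau> > T then K else K * \<tau>) \<le> K * T + 2 * real N * K"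
proof -
  let ?late = "{k \<in> {..<n}. real (k + N) * \<tau> > T}"
  have "(\<Sum>k<n. if k < N \<or> real (k + N) * \<tau> > T then K else K * \<tau>)
      \<le> (\<Sum>k<n. K * \<tau> + (if k < N then K else 0) + (if real (k + N) * \<tau> > T then K else 0))"
    using assms by (intro sum_mono) auto
  also have "\<dots> = real n * (K * \<tau>) + K * real (card {k \<in> {..<n}. k < N}) + K * real (card ?late)"
    by (simp add: sum.distrib sum.If_cases Int_def)
  also have "\<dots> \<le> K * T + K * real N + K * real N"
  proof (intro add_mono mult_left_mono[OF _ assms(1)])
    show "real n * (K * \<tau>) \<le> K * T"
      using mult_left_mono[OF assms(3,1)] by (simp add: mult_ac)
    have "card {k \<in> {..<n}. k < N} \<le> card {..<N}"
      by (intro card_mono) auto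
    then show "real (card {k \<in> {..<n}. k < N}) \<le> real N"
      by simp
    have "?late \<subseteq> {n - N..<n}"
    proof
      fix k assume k: "k \<in> ?late"
      then have "real n * \<tau> < real (k + N) * \<tau>"
        using assms(3) by auto
      then have "n < k + N"
        using assms(2) by (simp only: mult_less_cancel_right_pos of_nat_less_iff)
      then show "k \<in> {n - N..<n}"
        using k by auto
    qed
    then have "card ?late \<le> card {n - N..<n}"
      by (intro card_mono) auto
    then show "real (card ?late) \<le> real N"
      by simp
  qed
  finally show ?thesis
    by (simp add: algebra_simps)
qed

section \<open>Operators of Kato type\<close>

locale kato_operators =
  fixes J :: "'y::real_inner \<Rightarrow> 'x::real_inner"
    and DA :: "'y \<Rightarrow> 'x set"
    and A B :: "'y \<Rightarrow> 'x \<Rightarrow> 'x"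
    and S :: "'y \<Rightarrow> 'x"
    and MA MB LA LB :: "real \<Rightarrow> real"
  assumes embedding: "dense_embedding J"
    and closed_A: "\<And>y. closed_linear_operator (DA y) (A y)"
    and K1: "cond_K1 J DA A MA"
    and K2: "cond_K2 J DA A B S MB"
    and K3: "cond_K3 J A B LA LB"
begin

lemma J_linear: "linear J" and J_bounded_linear: "bounded_linear J"
  using embedding by (auto simp: dense_embedding_def bounded_linear.linear)

lemma J_inj: "J y = J z \<longleftrightarrow> y = z"
  using embedding by (auto simp: dense_embedding_def inj_def)

lemma norm_J_le: "norm (J y) \<le> norm y"
  using embedding by (auto simp: dense_embedding_def)

lemma S_linear: "linear S" and norm_S: "norm (S y) = norm y"
  using K2 by (auto simp: cond_K2_def)

lemma S_bounded_linear: "bounded_linear S"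
  using S_linear norm_S by (intro bounded_linear_intro[of S 1]) (auto simp: linear_add linear_scale)

lemma S_inj: "S y = S z \<longleftrightarrow> y = z"
  using norm_S[of "y - z"] linear_diff[OF S_linear, of y z] by auto

lemmas J_simps = linear_add[OF J_linear] linear_diff[OF J_linear] linear_scale[OF J_linear]
  linear_neg[OF J_linear] linear_sum[OF J_linear]

lemmas S_simps = linear_add[OF S_linear] linear_diff[OF S_linear] linear_scale[OF S_linear]
  linear_neg[OF S_linear] linear_sum[OF S_linear]

lemma inner_S: "inner (S y) (S z) = inner y z"
proof -
  have "inner (S (y + z)) (S (y + z)) = inner (y + z) (y + z)"
    "inner (S y) (S y) = inner y y" "inner (S z) (S z) = inner z z"
    by (simp_all only: power2_norm_eq_inner[symmetric] norm_S)
  then show ?thesis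
    by (simp add: S_simps inner_add_left inner_add_right inner_commute)
qed

text \<open>
  This is self-adjointness of \<open>S\<close> as an operator on \<open>X\<close>, read off at the pair \<open>(J z, S z)\<close> of its graph.
\<close>

lemma S_symmetric: "inner (S y) (J z) = inner (J y) (S z)"
proof -
  have inv: "inv J (J w) = w" for w
    using embedding by (simp add: dense_embedding_def)
  have "(J z, S (inv J (J z))) \<in> adjoint_graph (range J) (\<lambda>v. S (inv J v))"
    using K2 by (auto simp: cond_K2_def self_adjoint_operator_def operator_graph_def)
  then show ?thesis
    by (auto simp: adjoint_graph_def inv)
qed

lemma J_in_DA: "J w \<in> DA y"
  using K1 unfolding cond_K1_def by blast

lemma A_diff: "v \<in> DA y \<Longrightarrow> w \<in> DA y \<Longrightarrow> v - w \<in> DA y \<and> A y (v - w) = A y v - A y w"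
proof -
  assume vw: "v \<in> DA y" "w \<in> DA y"
  have lin: "linear_operator (DA y) (A y)"
    using closed_A by (simp add: closed_linear_operator_def)
  have "v + (- 1) *\<^sub>R w \<in> DA y \<and> A y (v + (- 1) *\<^sub>R w) = A y v + (- 1) *\<^sub>R A y w"
    using lin vw unfolding linear_operator_def
    by (metis subspace_add subspace_scale)
  then show ?thesis by simp
qed

lemma A_accretive: "w \<in> DA y \<Longrightarrow> inner w (A y w) \<ge> 0"
  using K1 by (auto simp: cond_K1_def)

lemma norm_A_le: "0 < R \<Longrightarrow> norm y \<le> R \<Longrightarrow> norm (A y (J w)) \<le> \<bar>MA R\<bar> * norm w"
  using K1 unfolding cond_K1_def
  by (meson abs_ge_self mult_right_mono norm_ge_zero order_trans)

lemma norm_B_le: "0 < R \<Longrightarrow> norm y \<le> R \<Longrightarrow> norm (B y v) \<le> \<bar>MB R\<bar> * norm v"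
  using K2 unfolding cond_K2_def
  by (meson abs_ge_self mult_right_mono norm_ge_zero order_trans)

lemma A_lipschitz:
  assumes "0 < R" "norm y \<le> R" "norm z \<le> R"
  shows "norm (A y (J w) - A z (J w)) \<le> \<bar>LA R\<bar> * norm (y - z) * norm w"
proof -
  have "norm (A y (J w) - A z (J w)) \<le> LA R * norm (J y - J z) * norm w"
    using K3 assms unfolding cond_K3_def by blast
  also have "\<dots> \<le> \<bar>LA R\<bar> * norm (J y - J z) * norm w"
    by (intro mult_right_mono) auto
  also have "\<dots> \<le> \<bar>LA R\<bar> * norm (y - z) * norm w"
    using norm_J_le[of "y - z"] by (intro mult_right_mono mult_left_mono) (auto simp: J_simps)
  finally show ?thesis .
qed

lemma B_lipschitz:
  assumes "0 < R" "norm y \<le> R" "norm z \<le> R"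
  shows "norm (B y v - B z v) \<le> \<bar>LB R\<bar> * norm (y - z) * norm v"
proof -
  have "norm (B y v - B z v) \<le> LB R * norm (y - z) * norm v"
    using K3 assms unfolding cond_K3_def by blast
  also have "\<dots> \<le> \<bar>LB R\<bar> * norm (y - z) * norm v"
    by (intro mult_right_mono) auto
  finally show ?thesis .
qed

text \<open>
  The equality of domains in \<open>S A(y) S\<^sup>-\<^sup>1 = A(y) + B(y)\<close>: in particular, \<open>A(y)\<close> maps \<open>w\<close> into \<open>Y\<close> as soon
  as \<open>S w\<close> lies in \<open>Y\<close>, since \<open>Y\<close> is contained in every domain.
\<close>

lemma A_in_Y_iff: "A y (J w) \<in> range J \<longleftrightarrow> S w \<in> DA y"
proof -
  have "conj_domain J S (DA y) (A y) = DA y"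
    using K2 by (simp add: cond_K2_def)
  then have "S w \<in> DA y \<longleftrightarrow> S w \<in> conj_domain J S (DA y) (A y)"
    by simp
  then show ?thesis
    using J_in_DA by (auto simp: conj_domain_def S_inj)
qed

lemma S_A_commutation:
  assumes "A y (J w) = J z"
  shows "S z = A y (S w) + B y (S w)"
proof -
  have "S w \<in> DA y"
    using assms A_in_Y_iff by auto
  then have "conj_operator J S (A y) (S w) = A y (S w) + B y (S w)"
    using K2 by (simp add: cond_K2_def)
  moreover have "inv S (S w) = w" "inv J (J z) = z"
    by (auto intro!: inv_f_f simp: inj_def S_inj J_inj)
  ultimately show ?thesis
    by (simp add: conj_operator_def assms)
qed

text \<open>
  Under \<open>S\<close> the difference becomes \<open>(A(y) - A(z)) S w + (B(y) - B(z)) S w\<close>, and the Lipschitz condition on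
  \<open>A\<close> costs the \<open>Y\<close>-norm of \<open>S w\<close>.  This is where \<open>S u\<close> has to take values in \<open>Y\<close>.
\<close>

lemma A_difference_in_Y:
  assumes R: "0 < R" "norm y \<le> R" "norm z \<le> R" and V: "S w = J V"
  obtains g where "J g = A y (J w) - A z (J w)" "norm g \<le> (\<bar>LA R\<bar> + \<bar>LB R\<bar>) * norm (y - z) * norm V"
proof -
  obtain gy gz where gy: "A y (J w) = J gy" and gz: "A z (J w) = J gz"
    using A_in_Y_iff V J_in_DA by (metis imageE)
  have "S (gy - gz) = (A y (J V) - A z (J V)) + (B y (J V) - B z (J V))"
    using S_A_commutation[OF gy] S_A_commutation[OF gz] V by (simp add: S_simps)
  then have "norm (gy - gz) \<le> norm (A y (J V) - A z (J V)) + norm (B y (J V) - B z (J V))"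
    by (metis norm_S norm_triangle_ineq)
  also have "\<dots> \<le> \<bar>LA R\<bar> * norm (y - z) * norm V + \<bar>LB R\<bar> * norm (y - z) * norm V"
  proof (intro add_mono A_lipschitz R)
    have "norm (B y (J V) - B z (J V)) \<le> \<bar>LB R\<bar> * norm (y - z) * norm (J V)"
      by (rule B_lipschitz[OF R])
    also have "\<dots> \<le> \<bar>LB R\<bar> * norm (y - z) * norm V"
      using norm_J_le by (intro mult_left_mono) auto
    finally show "norm (B y (J V) - B z (J V)) \<le> \<bar>LB R\<bar> * norm (y - z) * norm V" .
  qed
  finally show thesis
    using that[of "gy - gz"] gy gz by (simp add: J_simps algebra_simps)
qed

lemma A_quasi_accretive_Y:
  assumes R: "0 < R" "norm y \<le> R" and g: "A y (J w) = J g"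
  shows "inner w g \<ge> - \<bar>MB R\<bar> * (norm w)\<^sup>2"
proof -
  have "S w \<in> DA y"
    using g A_in_Y_iff by auto
  then have acc: "inner (S w) (A y (S w)) \<ge> 0"
    by (rule A_accretive)
  have "\<bar>inner (S w) (B y (S w))\<bar> \<le> norm w * (\<bar>MB R\<bar> * norm w)"
    using norm_B_le[OF R, of "S w"] Cauchy_Schwarz_ineq2[of "S w" "B y (S w)"]
    by (metis mult_left_mono norm_S norm_ge_zero order_trans)
  then have "inner (S w) (A y (S w) + B y (S w)) \<ge> - (norm w * (\<bar>MB R\<bar> * norm w))"
    using acc by (simp add: inner_add_right)
  then show ?thesis
    using inner_S[of w g] S_A_commutation[OF g] by (simp add: power2_eq_square mult_ac)
qed

lemma norm_A_Y_le:
  assumes R: "0 < R" "norm y \<le> R" and g: "A y (J w) = J g" and V: "S w = J V"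
  shows "norm g \<le> (\<bar>MA R\<bar> + \<bar>MB R\<bar>) * norm V"
proof -
  have "norm g = norm (A y (J V) + B y (J V))"
    using S_A_commutation[OF g] V norm_S[of g] by simp
  also have "\<dots> \<le> \<bar>MA R\<bar> * norm V + \<bar>MB R\<bar> * norm V"
  proof (intro norm_triangle_mono norm_A_le R)
    have "\<bar>MB R\<bar> * norm (J V) \<le> \<bar>MB R\<bar> * norm V"
      using norm_J_le by (intro mult_left_mono) auto
    then show "norm (B y (J V)) \<le> \<bar>MB R\<bar> * norm V"
      using norm_B_le[OF R, of "J V"] by linarith
  qed
  finally show ?thesis
    by (simp add: algebra_simps)
qed

text \<open>
  Here \<open>y\<close> is a numerical stage and \<open>z\<close> a comparison stage with residual \<open>r\<close>; the nonlinear terms are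
  split as \<open>A(y) y - A(z) z = A(y) (y - z) + (A(y) - A(z)) z\<close>.  The first estimate is one-sided and in \<open>Y\<close>, the
  second is two-sided but only in \<open>X\<close>.
\<close>

lemma stage_error_estimates:
  assumes R: "0 < R" "norm y \<le> R" "norm z \<le> R" "norm V \<le> R" and V: "S z = J V"
    and y': "J y' = - A y (J y)" and z': "J z' = J r - A z (J z)"
  shows "inner (y - z) (y' - z') \<le> (\<bar>MB R\<bar> + (\<bar>LA R\<bar> + \<bar>LB R\<bar>) * R) * (norm (y - z))\<^sup>2 + norm r * norm (y - z)"
    and "norm (J (y' - z')) \<le> (\<bar>MA R\<bar> + (\<bar>LA R\<bar> + \<bar>LB R\<bar>) * R) * norm (y - z) + norm r"
proof -
  let ?L = "\<bar>LA R\<bar> + \<bar>LB R\<bar>"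
  obtain g where g: "J g = A y (J z) - A z (J z)" "norm g \<le> ?L * norm (y - z) * norm V"
    using A_difference_in_Y[OF R(1-3) V] by blast
  have "?L * norm (y - z) * norm V \<le> ?L * norm (y - z) * R"
    using R(4) by (intro mult_left_mono) auto
  with g(2) have norm_g: "norm g \<le> ?L * R * norm (y - z)"
    by (simp add: mult_ac)
  have AE: "A y (J (y - z)) = J (- (y' - z') - g - r)"
    using A_diff[of "J y" y "J z"] J_in_DA y' z' g(1) by (simp add: J_simps)
  have "inner (y - z) (- (y' - z') - g - r) \<ge> - \<bar>MB R\<bar> * (norm (y - z))\<^sup>2"
    by (rule A_quasi_accretive_Y[OF R(1,2) AE])
  moreover have "- inner (y - z) g \<le> norm (y - z) * (?L * R * norm (y - z))"
    using Cauchy_Schwarz_ineq2[of "y - z" g] norm_g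
    by (smt (verit, best) mult_left_mono norm_ge_zero)
  moreover have "- inner (y - z) r \<le> norm (y - z) * norm r"
    using Cauchy_Schwarz_ineq2[of "y - z" r] by linarith
  ultimately show "inner (y - z) (y' - z') \<le> (\<bar>MB R\<bar> + ?L * R) * (norm (y - z))\<^sup>2 + norm r * norm (y - z)"
    by (simp add: inner_diff_right inner_add_right power2_eq_square algebra_simps)
  have "J (y' - z') = - (A y (J (y - z)) + J g + J r)"
    unfolding AE by (simp add: J_simps)
  then have "norm (J (y' - z')) = norm (A y (J (y - z)) + J g + J r)"
    by (simp only: norm_minus_cancel)
  also have "\<dots> \<le> norm (A y (J (y - z))) + norm (J g) + norm (J r)"
    by (intro norm_triangle_mono order_refl)
  also have "\<dots> \<le> \<bar>MA R\<bar> * norm (y - z) + ?L * R * norm (y - z) + norm r"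
    using norm_A_le[OF R(1,2)] norm_g norm_J_le order_trans by (intro add_mono) blast+
  finally show "norm (J (y' - z')) \<le> (\<bar>MA R\<bar> + ?L * R) * norm (y - z) + norm r"
    by (simp add: algebra_simps)
qed

section \<open>Stability of a single step\<close>

text \<open>
  The equations of one step, separated from the stage bounds in \<open>rk_stages\<close>.
\<close>

definition rk_step :: "real^'m^'m \<Rightarrow> real^'m \<Rightarrow> real \<Rightarrow> 'y \<Rightarrow> 'y \<Rightarrow> ('m::finite \<Rightarrow> 'y) \<Rightarrow> bool" where
  "rk_step a b \<tau> w w1 U \<longleftrightarrow>
     (\<forall>i. J (U i) = J w + \<tau> *\<^sub>R (\<Sum>j\<in>UNIV. a $ i $ j *\<^sub>R stage_dot J A (U j))) \<and>
     J w1 = J w + \<tau> *\<^sub>R (\<Sum>i\<in>UNIV. b $ i *\<^sub>R stage_dot J A (U i))"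

text \<open>
  Inverting \<open>a\<close> expresses the stage derivatives by differences of stages, which lie in \<open>Y\<close>.
\<close>

lemma stage_dot_in_Y:
  fixes a :: "real^'m^'m" and U :: "'m::finite \<Rightarrow> 'y"
  assumes inv: "invertible a" and \<tau>: "\<tau> \<noteq> 0"
    and stages: "\<And>i. J (U i) = J w + \<tau> *\<^sub>R (\<Sum>j\<in>UNIV. a $ i $ j *\<^sub>R stage_dot J A (U j))"
  shows "stage_dot J A (U i) \<in> range J"
proof -
  obtain W where W: "W ** a = mat 1"
    using inv by (auto simp: invertible_def)
  have "(\<Sum>j\<in>UNIV. W $ i $ j *\<^sub>R (J (U j) - J w))
      = \<tau> *\<^sub>R (\<Sum>j\<in>UNIV. \<Sum>k\<in>UNIV. (W $ i $ j * a $ j $ k) *\<^sub>R stage_dot J A (U k))"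
    unfolding stages by (simp add: scaleR_sum_right mult_ac)
  also have "(\<Sum>j\<in>UNIV. \<Sum>k\<in>UNIV. (W $ i $ j * a $ j $ k) *\<^sub>R stage_dot J A (U k))
      = (\<Sum>k\<in>UNIV. (W ** a) $ i $ k *\<^sub>R stage_dot J A (U k))"
    by (subst sum.swap) (simp add: matrix_matrix_mult_def scaleR_sum_left)
  also have "\<dots> = (\<Sum>k\<in>UNIV. if k = i then stage_dot J A (U i) else 0)"
    unfolding W by (intro sum.cong) (auto simp: mat_def)
  finally have "stage_dot J A (U i) = J ((1 / \<tau>) *\<^sub>R (\<Sum>j\<in>UNIV. W $ i $ j *\<^sub>R (U j - w)))"
    using \<tau> by (simp add: J_simps)
  then show ?thesis by blast
qed

text \<open>
  \<open>v\<close> and \<open>v1\<close> solve the equations of one step up to defects, with stages \<open>Z\<close> and stage derivatives \<open>Z'\<close>.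
  The bound \<open>\<beta>\<close> is for the residual in the differential equation, \<open>\<epsilon>\<close> for the stage defects and
  \<open>\<eta>\<close> for the quadrature defect.  The images under \<open>S\<close> of \<open>Z\<close> and of the stage defects are required to
  lie in \<open>Y\<close>, where they are called \<open>V\<close> and \<open>\<delta>\<close>; so \<open>\<epsilon>\<close> bounds the stage defects in a norm stronger than
  that of \<open>Y\<close>.
\<close>

definition approx_step ::
    "real^'m^'m \<Rightarrow> real^'m \<Rightarrow> real \<Rightarrow> real \<Rightarrow> 'y \<Rightarrow> 'y \<Rightarrow> real \<Rightarrow> real \<Rightarrow> real \<Rightarrow> bool" where
  "approx_step a b R \<tau> v v1 \<epsilon> \<beta> \<eta> \<longleftrightarrow>
     (\<exists>(Z :: 'm::finite \<Rightarrow> 'y) Z' V \<delta> r.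
        (\<forall>i. norm (Z i) \<le> R \<and> norm (V i) \<le> R \<and> S (Z i) = J (V i)) \<and>
        (\<forall>i. J (Z' i) = J (r i) - A (Z i) (J (Z i)) \<and> norm (r i) \<le> \<beta>) \<and>
        (\<forall>i. S (Z i - v - \<tau> *\<^sub>R (\<Sum>j\<in>UNIV. a $ i $ j *\<^sub>R Z' j)) = J (\<delta> i) \<and> norm (\<delta> i) \<le> \<epsilon>) \<and>
        norm (v1 - v - \<tau> *\<^sub>R (\<Sum>i\<in>UNIV. b $ i *\<^sub>R Z' i)) \<le> \<eta>)"

text \<open>
  Without the quadrature defect the new error has the norm \<open>p\<close>, to which algebraic stability applies;
  in the resulting terms the stage errors are replaced by their coercivity bound.  Stage defects \<open>\<epsilon>\<close> of
  the size of the target accuracy then raise the squared error by \<open>O(\<tau> * \<epsilon>\<^sup>2)\<close>, whereas residuals with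
  \<open>\<tau> * \<beta>\<close> of that size raise it by \<open>O((\<tau> * \<beta>)\<^sup>2)\<close>, which is affordable in boundedly many steps only.
\<close>

lemma rk_step_stability:
  fixes a :: "real^'m::finite^'m" and b :: "real^'m"
  assumes coer: "coercive a" and stab: "algebraically_stable a b" and R: "R > 0"
  shows "\<exists>\<tau>0>0. \<exists>K\<ge>0. \<forall>\<tau> w w1 U v v1 \<epsilon> \<beta> \<eta>.
      0 < \<tau> \<and> \<tau> \<le> \<tau>0 \<and> rk_step a b \<tau> w w1 U \<and> (\<forall>i. norm (U i) \<le> R) \<and> approx_step a b R \<tau> v v1 \<epsilon> \<beta> \<eta>
      \<longrightarrow> (\<exists>p\<ge>0. norm (w1 - v1) \<le> p + \<eta> \<and>
            p\<^sup>2 \<le> (norm (w - v))\<^sup>2 + K * (norm (w - v) + \<epsilon> + \<tau> * \<beta>) * (\<tau> * (norm (w - v) + \<epsilon>) + \<tau> * \<beta>))"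
proof -
  obtain \<kappa> C :: real where \<kappa>: "\<kappa> > 0" and C: "C \<ge> 1"
    and stage_bound: "\<forall>(E :: 'm \<Rightarrow> 'y) F d e \<tau> K \<beta> \<epsilon>.
      (\<forall>i. E i = e + \<tau> *\<^sub>R (\<Sum>j\<in>UNIV. a $ i $ j *\<^sub>R F j) - d i) \<and> (\<forall>i. norm (d i) \<le> \<epsilon>) \<and>
      (\<forall>i. inner (E i) (F i) \<le> K * (norm (E i))\<^sup>2 + \<beta> * norm (E i)) \<and>
      0 \<le> \<tau> \<and> 0 \<le> \<beta> \<and> \<tau> * K \<le> \<kappa> \<longrightarrow> (\<forall>i. norm (E i) \<le> C * (norm e + \<epsilon> + \<tau> * \<beta>))"
    using coercive_stage_bound[where 'v = 'y, OF coer] by blast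
  define c1 where "c1 = \<bar>MB R\<bar> + (\<bar>LA R\<bar> + \<bar>LB R\<bar>) * R"
  define c2 where "c2 = \<bar>MA R\<bar> + (\<bar>LA R\<bar> + \<bar>LB R\<bar>) * R"
  have c12: "c1 \<ge> 0" "c2 \<ge> 0"
    using R by (auto simp: c1_def c2_def)
  define \<tau>0 where "\<tau>0 = min 1 (\<kappa> / (c1 + 1))"
  have \<tau>0: "\<tau>0 > 0" "\<tau>0 \<le> 1"
    using \<kappa> c12 by (auto simp: \<tau>0_def)
  have \<tau>K: "\<tau> * c1 \<le> \<kappa>" if "0 < \<tau>" "\<tau> \<le> \<tau>0" for \<tau>
  proof -
    have "\<tau> * (c1 + 1) \<le> \<kappa>"
      using that c12 by (simp add: \<tau>0_def pos_le_divide_eq)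
    then show ?thesis
      using that by (simp add: algebra_simps)
  qed
  define c3 where "c3 = c1 * C\<^sup>2 + C + c2 * C + 1"
  define bs where "bs = (\<Sum>i\<in>UNIV. b $ i)"
  have b: "b $ i > 0" for i
    using stab by (simp add: algebraically_stable_def)
  have pos: "c3 \<ge> 0" "bs \<ge> 0"
    using c12 C b by (simp_all add: c3_def bs_def sum_nonneg less_imp_le)
  show ?thesis
  proof (rule exI[of _ \<tau>0], rule conjI[OF \<tau>0(1)], rule exI[of _ "4 * bs * c3"], rule conjI,
      use pos in simp, intro allI impI, elim conjE)
    fix \<tau> w w1 U v v1 \<epsilon> \<beta> \<eta>
    assume \<tau>: "0 < \<tau>" "\<tau> \<le> \<tau>0" and step: "rk_step a b \<tau> w w1 U" and U: "\<forall>i. norm (U i) \<le> R"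
      and "approx_step a b R \<tau> v v1 \<epsilon> \<beta> \<eta>"
    then obtain Z Z' V \<delta> r where
      bounds: "\<And>i. norm (Z i) \<le> R" "\<And>i. norm (V i) \<le> R"
      and V: "\<And>i. S (Z i) = J (V i)"
      and Z': "\<And>i. J (Z' i) = J (r i) - A (Z i) (J (Z i))" and r: "\<And>i. norm (r i) \<le> \<beta>"
      and \<delta>: "\<And>i. S (Z i - v - \<tau> *\<^sub>R (\<Sum>j\<in>UNIV. a $ i $ j *\<^sub>R Z' j)) = J (\<delta> i)" "\<And>i. norm (\<delta> i) \<le> \<epsilon>"
      and \<eta>: "norm (v1 - v - \<tau> *\<^sub>R (\<Sum>i\<in>UNIV. b $ i *\<^sub>R Z' i)) \<le> \<eta>"
      unfolding approx_step_def by blast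
    have stages: "J (U i) = J w + \<tau> *\<^sub>R (\<Sum>j\<in>UNIV. a $ i $ j *\<^sub>R stage_dot J A (U j))" for i
      using step by (simp add: rk_step_def)
    have "\<forall>i. \<exists>y. stage_dot J A (U i) = J y"
      using stage_dot_in_Y[OF _ _ stages] coer \<tau> by (auto simp: coercive_def image_iff)
    then obtain U' where U': "\<And>i. stage_dot J A (U i) = J (U' i)"
      by metis
    define x where "x = norm (w - v)"
    define d where "d i = Z i - v - \<tau> *\<^sub>R (\<Sum>j\<in>UNIV. a $ i $ j *\<^sub>R Z' j)" for i
    define E where "E i = U i - Z i" for i
    define F where "F i = U' i - Z' i" for i
    have norm_d: "norm (d i) \<le> \<epsilon>" for i
      using norm_S[of "d i"] norm_J_le[of "\<delta> i"] \<delta>[of i] by (simp add: d_def)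
    have \<beta>: "\<beta> \<ge> 0" and \<epsilon>: "\<epsilon> \<ge> 0"
      using r \<delta>(2) norm_ge_zero order_trans by blast+
    have "U i = w + \<tau> *\<^sub>R (\<Sum>j\<in>UNIV. a $ i $ j *\<^sub>R U' j)" for i
      using stages[of i] unfolding U' by (simp flip: J_inj add: J_simps)
    then have E_eq: "E i = (w - v) + \<tau> *\<^sub>R (\<Sum>j\<in>UNIV. a $ i $ j *\<^sub>R F j) - d i" for i
      by (simp add: E_def F_def d_def algebra_simps sum_subtractf)
    have energy: "inner (E i) (F i) \<le> c1 * (norm (E i))\<^sup>2 + \<beta> * norm (E i)"
      and norm_F: "norm (J (F i)) \<le> c2 * norm (E i) + \<beta>" for i
    proof -
      have "J (U' i) = - A (U i) (J (U i))"
        using U'[of i] by (simp add: stage_dot_def)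
      note * = stage_error_estimates[OF R U[rule_format, of i] bounds(1)[of i] bounds(2)[of i] V this Z',
          folded E_def F_def c1_def c2_def]
      have "norm (r i) * norm (E i) \<le> \<beta> * norm (E i)"
        using r by (rule mult_right_mono) simp
      then show "inner (E i) (F i) \<le> c1 * (norm (E i))\<^sup>2 + \<beta> * norm (E i)"
        "norm (J (F i)) \<le> c2 * norm (E i) + \<beta>"
        using * r[of i] by linarith+
    qed
    define g where "g = x + \<epsilon> + \<tau> * \<beta>"
    have g: "0 \<le> g" "\<epsilon> \<le> g"
      using \<epsilon> \<beta> \<tau> by (auto simp: g_def x_def)
    have norm_E: "norm (E i) \<le> C * g" for i
      unfolding g_def x_def
      using E_eq norm_d energy \<beta> \<tau> \<tau>K
      by (intro stage_bound[rule_format, where F = F and d = d and K = c1]) (blast intro: less_imp_le)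
    have summand: "inner (E i + d i) (F i) \<le> c3 * g * (g + \<beta>)" for i
    proof -
      \<comment> \<open>\<open>F i\<close> is controlled in \<open>X\<close> only, so one factor \<open>S\<close> is moved to the stage defect.\<close>
      have "inner (d i) (F i) = inner (J (\<delta> i)) (S (F i))"
        using \<delta>(1)[of i] inner_S[of "d i" "F i"] by (simp add: d_def)
      also have "\<dots> = inner (S (\<delta> i)) (J (F i))"
        using S_symmetric by simp
      also have "\<dots> \<le> norm (\<delta> i) * norm (J (F i))"
        using norm_cauchy_schwarz[of "S (\<delta> i)" "J (F i)"] by (simp add: norm_S)
      also have "\<dots> \<le> g * (c2 * (C * g) + \<beta>)"
      proof (intro mult_mono)
        show "norm (\<delta> i) \<le> g"
          using \<delta>(2)[of i] g by linarith
        show "norm (J (F i)) \<le> c2 * (C * g) + \<beta>"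
          using norm_F[of i] mult_left_mono[OF norm_E[of i] c12(2)] by linarith
      qed (use g in auto)
      finally have "inner (d i) (F i) \<le> g * (c2 * (C * g) + \<beta>)" .
      moreover have "inner (E i) (F i) \<le> c1 * (C * g)\<^sup>2 + \<beta> * (C * g)"
      proof -
        have "c1 * (norm (E i))\<^sup>2 \<le> c1 * (C * g)\<^sup>2"
          using norm_E c12 by (intro mult_left_mono power_mono) auto
        moreover have "\<beta> * norm (E i) \<le> \<beta> * (C * g)"
          using norm_E \<beta> by (intro mult_left_mono) auto
        ultimately show ?thesis
          using energy[of i] by linarith
      qed
      ultimately have "inner (E i + d i) (F i) \<le> (c1 * C\<^sup>2 + c2 * C) * g * g + (C + 1) * g * \<beta>"
        by (simp add: inner_add_left power2_eq_square algebra_simps)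
      also have "\<dots> \<le> c3 * g * g + c3 * g * \<beta>"
      proof -
        have "c1 * C\<^sup>2 + c2 * C \<le> c3" "C + 1 \<le> c3"
          using c12 C by (simp_all add: c3_def)
        then show ?thesis
          using g \<beta> by (meson add_mono mult_right_mono)
      qed
      finally show ?thesis
        by (simp add: algebra_simps)
    qed
    define p where "p = norm ((w - v) + \<tau> *\<^sub>R (\<Sum>i\<in>UNIV. b $ i *\<^sub>R F i))"
    have "p\<^sup>2 \<le> x\<^sup>2 + 2 * \<tau> * (\<Sum>i\<in>UNIV. b $ i * inner (E i + d i) (F i))"
      unfolding p_def x_def by (rule algebraic_stability_estimate[OF stab E_eq])
    also have "(\<Sum>i\<in>UNIV. b $ i * inner (E i + d i) (F i)) \<le> bs * (c3 * g * (g + \<beta>))"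
      unfolding bs_def sum_distrib_right using summand b by (intro sum_mono mult_left_mono) (auto simp: less_imp_le)
    also have "2 * \<tau> * (bs * (c3 * g * (g + \<beta>))) = 2 * bs * c3 * g * (\<tau> * g + \<tau> * \<beta>)"
      by (simp add: algebra_simps)
    also have "\<dots> \<le> 2 * bs * c3 * g * (2 * (\<tau> * (x + \<epsilon>) + \<tau> * \<beta>))"
    proof (rule mult_left_mono)
      have "\<tau> * (\<tau> * \<beta>) \<le> 1 * (\<tau> * \<beta>)" "0 \<le> \<tau> * (x + \<epsilon>)"
        using \<tau> \<tau>0 \<beta> \<epsilon> by (intro mult_right_mono mult_nonneg_nonneg; simp add: x_def)+
      then show "\<tau> * g + \<tau> * \<beta> \<le> 2 * (\<tau> * (x + \<epsilon>) + \<tau> * \<beta>)"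
        by (simp add: g_def algebra_simps)
    qed (use pos g in simp)
    finally have "p\<^sup>2 \<le> x\<^sup>2 + 4 * bs * c3 * g * (\<tau> * (x + \<epsilon>) + \<tau> * \<beta>)"
      using \<tau> by (simp add: algebra_simps)
    moreover have "norm (w1 - v1) \<le> p + \<eta>"
    proof -
      have "w1 = w + \<tau> *\<^sub>R (\<Sum>i\<in>UNIV. b $ i *\<^sub>R U' i)"
        using step by (simp flip: J_inj add: J_simps rk_step_def U')
      then have diff: "w1 - v1 = ((w - v) + \<tau> *\<^sub>R (\<Sum>i\<in>UNIV. b $ i *\<^sub>R F i))
          - (v1 - v - \<tau> *\<^sub>R (\<Sum>i\<in>UNIV. b $ i *\<^sub>R Z' i))"
        by (simp add: F_def algebra_simps sum_subtractf)
      show ?thesis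
        unfolding diff p_def
        by (rule order_trans[OF norm_triangle_ineq4 add_left_mono[OF \<eta>]])
    qed
    ultimately show "\<exists>p\<ge>0. norm (w1 - v1) \<le> p + \<eta> \<and> p\<^sup>2 \<le> (norm (w - v))\<^sup>2
        + 4 * bs * c3 * (norm (w - v) + \<epsilon> + \<tau> * \<beta>) * (\<tau> * (norm (w - v) + \<epsilon>) + \<tau> * \<beta>)"
      unfolding x_def g_def by (intro exI[of _ p]) (simp add: p_def)
  qed
qed

end

section \<open>Defects of the exact solution\<close>

lemma continuous_family_bounded:
  fixes d :: "nat \<Rightarrow> real \<Rightarrow> 'a::real_normed_vector"
  assumes "\<And>j. j \<le> N \<Longrightarrow> continuous_on {0..T} (d j)"
  obtains M where "\<And>j t. j \<le> N \<Longrightarrow> t \<in> {0..T} \<Longrightarrow> norm (d j t) \<le> M"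
proof -
  have "bounded (\<Union>j\<in>{..N}. d j ` {0..T})"
    using assms by (intro bounded_UN) (auto intro: compact_imp_bounded compact_continuous_image)
  then obtain M where "\<forall>x\<in>(\<Union>j\<in>{..N}. d j ` {0..T}). norm x \<le> M"
    unfolding bounded_iff by blast
  then show thesis
    by (intro that[of M]) auto
qed

text \<open>
  \<open>du j\<close> and \<open>dv j\<close> are the derivatives of order \<open>j\<close> of the solution \<open>u\<close> and of \<open>S u\<close>, both as functions
  with values in \<open>Y\<close>.
\<close>

locale kato_trajectory = kato_operators J DA A B S MA MB LA LB
  for J :: "'y::real_inner \<Rightarrow> 'x::real_inner" and DA A B S MA MB LA LB +
  fixes T :: real and q :: nat and du dv :: "nat \<Rightarrow> real \<Rightarrow> 'y"
  assumes T_pos: "T > 0"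
    and u_deriv: "\<And>j t. j < q + 2 \<Longrightarrow> t \<in> {0..T} \<Longrightarrow>
      (du j has_vector_derivative du (Suc j) t) (at t within {0..T})"
    and u_cont: "\<And>j. j \<le> q + 2 \<Longrightarrow> continuous_on {0..T} (du j)"
    and v_deriv: "\<And>j t. j < q + 1 \<Longrightarrow> t \<in> {0..T} \<Longrightarrow>
      (dv j has_vector_derivative dv (Suc j) t) (at t within {0..T})"
    and v_cont: "\<And>j. j \<le> q + 1 \<Longrightarrow> continuous_on {0..T} (dv j)"
    and S_u: "\<And>t. t \<in> {0..T} \<Longrightarrow> S (du 0 t) = J (dv 0 t)"
    and solution: "solution_on J A {0..T} (du 0)"
begin

lemma derivative_unique:
  assumes "t \<in> {0..T}" "\<And>s. s \<in> {0..T} \<Longrightarrow> f s = g s"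
    "(f has_vector_derivative f') (at t within {0..T})" "(g has_vector_derivative g') (at t within {0..T})"
  shows "f' = g'"
proof -
  have "(f has_vector_derivative g') (at t within {0..T})"
    by (rule has_vector_derivative_transform[OF assms(1) _ assms(4)]) (rule assms(2))
  then show ?thesis
    using vector_derivative_unique_within_closed_interval[of 0 T t f f' g'] assms T_pos by simp
qed

lemma J_u': "t \<in> {0..T} \<Longrightarrow> J (du 1 t) = - A (du 0 t) (J (du 0 t))"
proof -
  assume t: "t \<in> {0..T}"
  have "((\<lambda>s. J (du 0 s)) has_vector_derivative J (du 1 t)) (at t within {0..T})"
    using bounded_linear.has_vector_derivative[OF J_bounded_linear u_deriv[of 0 t]] t by simp
  moreover have "((\<lambda>s. J (du 0 s)) has_vector_derivative - A (du 0 t) (J (du 0 t))) (at t within {0..T})"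
    using solution t by (simp add: solution_on_def)
  ultimately show ?thesis
    using derivative_unique[OF t refl] by blast
qed

lemma S_u': "t \<in> {0..T} \<Longrightarrow> S (du 1 t) = J (dv 1 t)"
proof -
  assume t: "t \<in> {0..T}"
  have "((\<lambda>s. S (du 0 s)) has_vector_derivative S (du 1 t)) (at t within {0..T})"
    using bounded_linear.has_vector_derivative[OF S_bounded_linear u_deriv[of 0 t]] t by simp
  moreover have "((\<lambda>s. J (dv 0 s)) has_vector_derivative J (dv 1 t)) (at t within {0..T})"
    using bounded_linear.has_vector_derivative[OF J_bounded_linear v_deriv[of 0 t]] t by simp
  ultimately show ?thesis
    using derivative_unique[OF t, of "\<lambda>s. S (du 0 s)" "\<lambda>s. J (dv 0 s)"] S_u by blast
qed

lemma trajectory_bounded: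
  "\<exists>M\<ge>1. (\<forall>j\<le>q + 2. \<forall>t\<in>{0..T}. norm (du j t) \<le> M) \<and> (\<forall>j\<le>q + 1. \<forall>t\<in>{0..T}. norm (dv j t) \<le> M)"
proof -
  obtain M1 where M1: "\<And>j t. j \<le> q + 2 \<Longrightarrow> t \<in> {0..T} \<Longrightarrow> norm (du j t) \<le> M1"
    using continuous_family_bounded[of "q + 2" T du] u_cont by blast
  obtain M2 where M2: "\<And>j t. j \<le> q + 1 \<Longrightarrow> t \<in> {0..T} \<Longrightarrow> norm (dv j t) \<le> M2"
    using continuous_family_bounded[of "q + 1" T dv] v_cont by blast
  show ?thesis
    using M1 M2 by (intro exI[of _ "max 1 (max M1 M2)"]) (auto simp: le_max_iff_disj)
qed

text \<open>
  The comparison stages are \<open>u(t + c\<^sub>i \<tau>)\<close>, without residual.  Their defects are measured after application of \<open>S\<close>,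
  as the quadrature errors of \<open>S u\<close>.
\<close>

lemma interior_step_defects:
  fixes a :: "real^'m::finite^'m" and b :: "real^'m"
  assumes a: "stage_order a q" and b: "quadrature_order_ge a b (q + 1)"
    and M: "M \<ge> 0" "\<And>t. t \<in> {0..T} \<Longrightarrow> norm (du (q + 2) t) \<le> M"
      "\<And>t. t \<in> {0..T} \<Longrightarrow> norm (dv (q + 1) t) \<le> M"
    and R: "\<And>t. t \<in> {0..T} \<Longrightarrow> norm (du 0 t) \<le> R" "\<And>t. t \<in> {0..T} \<Longrightarrow> norm (dv 0 t) \<le> R"
  shows "\<exists>L\<ge>0. \<forall>\<tau> t. 0 < \<tau> \<and> t \<in> {0..T} \<and> t + \<tau> \<in> {0..T} \<and> (\<forall>i. t + rk_node a i * \<tau> \<in> {0..T}) \<longrightarrow>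
      approx_step a b R \<tau> (du 0 t) (du 0 (t + \<tau>)) (L * \<tau> ^ (q + 1)) 0 (L * \<tau> ^ (q + 2))"
proof -
  let ?c = "rk_node a"
  define La where "La i = M * (\<bar>?c i\<bar> ^ Suc q + (\<Sum>j\<in>UNIV. \<bar>a $ i $ j\<bar> * \<bar>?c j\<bar> ^ q))" for i
  define Lb where "Lb = M * (\<bar>1\<bar> ^ Suc (q + 1) + (\<Sum>j\<in>UNIV. \<bar>b $ j\<bar> * \<bar>?c j\<bar> ^ (q + 1)))"
  have La: "La i \<ge> 0" for i
    unfolding La_def using M by (intro mult_nonneg_nonneg add_nonneg_nonneg sum_nonneg) auto
  have Lb: "Lb \<ge> 0"
    unfolding Lb_def using M by (intro mult_nonneg_nonneg add_nonneg_nonneg sum_nonneg) auto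
  define L where "L = (\<Sum>i\<in>UNIV. La i) + Lb"
  have "La i \<le> (\<Sum>i\<in>UNIV. La i)" for i
    using La by (intro member_le_sum) auto
  then have L: "La i \<le> L" "Lb \<le> L" "L \<ge> 0" for i
    using La Lb by (auto simp: L_def intro: add_increasing2 sum_nonneg)
  have "approx_step a b R \<tau> (du 0 t) (du 0 (t + \<tau>)) (L * \<tau> ^ (q + 1)) 0 (L * \<tau> ^ (q + 2))"
    if \<tau>: "0 < \<tau>" and t: "t \<in> {0..T}" "t + \<tau> \<in> {0..T}" "\<And>i. t + ?c i * \<tau> \<in> {0..T}" for \<tau> t
  proof -
    define \<delta> where "\<delta> i = dv 0 (t + ?c i * \<tau>) - dv 0 t - \<tau> *\<^sub>R (\<Sum>j\<in>UNIV. a $ i $ j *\<^sub>R dv 1 (t + ?c j * \<tau>))" for i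
    have "norm (\<delta> i) \<le> La i * \<tau> ^ Suc q" for i
      unfolding \<delta>_def La_def
      using a M v_deriv t \<tau> by (intro quadrature_defect_bound[where I = "{0..T}"]) (auto simp: stage_order_def)
    then have \<delta>: "norm (\<delta> i) \<le> L * \<tau> ^ (q + 1)" for i
      using L(1)[of i] \<tau> by (smt (verit) Suc_eq_plus1 mult_right_mono zero_le_power)
    have "norm (du 0 (t + 1 * \<tau>) - du 0 t - \<tau> *\<^sub>R (\<Sum>j\<in>UNIV. b $ j *\<^sub>R du 1 (t + ?c j * \<tau>))) \<le> Lb * \<tau> ^ Suc (q + 1)"
      unfolding Lb_def
      using b M u_deriv t \<tau> by (intro quadrature_defect_bound[where I = "{0..T}"]) (auto simp: quadrature_order_ge_def)
    also have "\<dots> \<le> L * \<tau> ^ (q + 2)"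
      using L(2) \<tau> by (simp add: mult_right_mono)
    finally have \<eta>: "norm (du 0 (t + \<tau>) - du 0 t - \<tau> *\<^sub>R (\<Sum>j\<in>UNIV. b $ j *\<^sub>R du 1 (t + ?c j * \<tau>))) \<le> L * \<tau> ^ (q + 2)"
      by simp
    have S\<delta>: "S (du 0 (t + ?c i * \<tau>) - du 0 t - \<tau> *\<^sub>R (\<Sum>j\<in>UNIV. a $ i $ j *\<^sub>R du 1 (t + ?c j * \<tau>))) = J (\<delta> i)" for i
      unfolding S_simps J_simps \<delta>_def using S_u S_u' t by (simp del: One_nat_def)
    show ?thesis
      unfolding approx_step_def
      by (rule exI[of _ "\<lambda>i. du 0 (t + ?c i * \<tau>)"], rule exI[of _ "\<lambda>i. du 1 (t + ?c i * \<tau>)"],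
          rule exI[of _ "\<lambda>i. dv 0 (t + ?c i * \<tau>)"], rule exI[of _ \<delta>], rule exI[of _ "\<lambda>i. 0"],
          intro conjI allI)
        (use \<eta> in \<open>simp_all add: R[OF t(3)] \<delta> S\<delta> S_u[OF t(3)] J_u'[OF t(3)] linear_0[OF J_linear] del: One_nat_def\<close>)
  qed
  then show ?thesis
    using L(3) by blast
qed

text \<open>
  The comparison stages lie on the tangent at \<open>t\<close>.  Because \<open>c\<^sub>i\<close> is the sum of row \<open>i\<close> of \<open>a\<close>,
  they satisfy the stage equations exactly, and no value of \<open>u\<close> outside \<open>[0, T]\<close> is used.  The
  residual is \<open>O(\<tau>)\<close> in \<open>Y\<close>, by the Lipschitz conditions and because the tangent of \<open>S u\<close> lies in \<open>Y\<close>.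
\<close>

lemma boundary_step_defects:
  fixes a :: "real^'m::finite^'m" and b :: "real^'m"
  assumes b: "quadrature_order_ge a b (q + 1)"
    and M: "M \<ge> 0" "\<And>j t. j \<le> q + 2 \<Longrightarrow> t \<in> {0..T} \<Longrightarrow> norm (du j t) \<le> M"
      "\<And>j t. j \<le> q + 1 \<Longrightarrow> t \<in> {0..T} \<Longrightarrow> norm (dv j t) \<le> M"
    and c: "\<And>i. \<bar>rk_node a i\<bar> \<le> c" and R: "0 < R" "M * (1 + c) \<le> R"
  shows "\<exists>L\<ge>0. \<forall>\<tau> t. 0 < \<tau> \<and> \<tau> \<le> 1 \<and> t \<in> {0..T} \<and> t + \<tau> \<in> {0..T} \<longrightarrow>
      approx_step a b R \<tau> (du 0 t) (du 0 (t + \<tau>)) 0 (L * \<tau>) (L * \<tau>\<^sup>2)"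
proof -
  have c0: "0 \<le> c"
    using c[of undefined] by linarith
  define K where "K = (\<bar>LA R\<bar> + \<bar>LB R\<bar>) * R + (\<bar>MA R\<bar> + \<bar>MB R\<bar>)"
  have K: "K \<ge> 0"
    using R by (simp add: K_def)
  define L where "L = K * (c * M) + M"
  have L: "K * (c * M) \<le> L" "M \<le> L" "L \<ge> 0"
    using K M c0 by (auto simp: L_def)
  have "approx_step a b R \<tau> (du 0 t) (du 0 (t + \<tau>)) 0 (L * \<tau>) (L * \<tau>\<^sup>2)"
    if \<tau>: "0 < \<tau>" "\<tau> \<le> 1" and t: "t \<in> {0..T}" "t + \<tau> \<in> {0..T}" for \<tau> t
  proof -
    define Z where "Z i = du 0 t + (rk_node a i * \<tau>) *\<^sub>R du 1 t" for i
    define V where "V i = dv 0 t + (rk_node a i * \<tau>) *\<^sub>R dv 1 t" for i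
    have small: "norm ((rk_node a i * \<tau>) *\<^sub>R y) \<le> c * M * \<tau>" if "norm y \<le> M" for y :: 'y and i
    proof -
      have "\<bar>rk_node a i\<bar> * norm y \<le> c * M"
        using c that c0 by (intro mult_mono) auto
      then have "(\<bar>rk_node a i\<bar> * norm y) * \<tau> \<le> c * M * \<tau>"
        using \<tau> by (intro mult_right_mono) auto
      then show ?thesis
        using \<tau> by (simp add: abs_mult mult_ac)
    qed
    have shift: "norm ((rk_node a i * \<tau>) *\<^sub>R du 1 t) \<le> c * M * \<tau>" "norm ((rk_node a i * \<tau>) *\<^sub>R dv 1 t) \<le> c * M * \<tau>" for i
      using M t by (intro small; simp)+
    have "c * M * \<tau> \<le> c * M * 1"
      using \<tau> c0 M by (intro mult_left_mono) auto
    then have R': "M + c * M * \<tau> \<le> R"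
      using R by (simp add: algebra_simps)
    have ZV: "norm (Z i) \<le> R" "norm (V i) \<le> R" for i
      using M(2)[of 0 t] M(3)[of 0 t] t shift[of i] R' unfolding Z_def V_def
      by (smt (verit) norm_triangle_ineq zero_le)+
    have u: "norm (du 0 t) \<le> R"
      using M(2)[of 0 t] t R' M(1) c0 \<tau> by (smt (verit) mult_nonneg_nonneg zero_le)
    have SZ: "S (Z i) = J (V i)" for i
      using S_u S_u' t by (simp add: Z_def V_def J_simps S_simps)
    have "\<exists>r. J (du 1 t) = J r - A (Z i) (J (Z i)) \<and> norm r \<le> L * \<tau>" for i
    proof -
      \<comment> \<open>\<open>g\<close> is the effect of changing the operator and \<open>h\<close> that of changing its argument.\<close>
      obtain g where g: "J g = A (Z i) (J (Z i)) - A (du 0 t) (J (Z i))"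
        "norm g \<le> (\<bar>LA R\<bar> + \<bar>LB R\<bar>) * norm (Z i - du 0 t) * norm (V i)"
        using A_difference_in_Y[OF R(1) ZV(1) u SZ] by blast
      have "S (Z i - du 0 t) = J (V i - dv 0 t)"
        using SZ S_u t by (simp add: J_simps S_simps)
      moreover from this obtain h where h: "A (du 0 t) (J (Z i - du 0 t)) = J h"
        using A_in_Y_iff J_in_DA by (metis imageE)
      ultimately have norm_h: "norm h \<le> (\<bar>MA R\<bar> + \<bar>MB R\<bar>) * norm (V i - dv 0 t)"
        using norm_A_Y_le[OF R(1) u] by blast
      have "A (du 0 t) (J (Z i - du 0 t)) = A (du 0 t) (J (Z i)) - A (du 0 t) (J (du 0 t))"
        using A_diff J_in_DA by (simp add: J_simps)
      then have "J (du 1 t) = J (g + h) - A (Z i) (J (Z i))"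
        using g(1) h J_u' t by (simp add: J_simps algebra_simps)
      moreover have "norm (g + h) \<le> L * \<tau>"
      proof -
        have "norm g \<le> (\<bar>LA R\<bar> + \<bar>LB R\<bar>) * (c * M * \<tau>) * R"
          using g(2) shift[of i] ZV(2)[of i] R c0 M(1) \<tau>
          by (elim order_trans) (intro mult_mono mult_left_mono mult_nonneg_nonneg; simp add: Z_def)
        moreover have "norm h \<le> (\<bar>MA R\<bar> + \<bar>MB R\<bar>) * (c * M * \<tau>)"
          using norm_h shift[of i] by (elim order_trans) (intro mult_left_mono; simp add: V_def)
        ultimately have "norm (g + h) \<le> K * (c * M) * \<tau>"
          using norm_triangle_ineq[of g h] by (simp add: K_def algebra_simps)
        also have "\<dots> \<le> L * \<tau>"
          using L \<tau> by (intro mult_right_mono) auto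
        finally show ?thesis .
      qed
      ultimately show ?thesis by blast
    qed
    then obtain r where r: "\<And>i. J (du 1 t) = J (r i) - A (Z i) (J (Z i))" "\<And>i. norm (r i) \<le> L * \<tau>"
      by metis
    have bsum: "(\<Sum>i\<in>UNIV. b $ i) = 1"
      using b[unfolded quadrature_order_ge_def, rule_format, of 1] by simp
    have "norm (du 0 (t + \<tau>) - (\<Sum>k<2. ((t + \<tau> - t) ^ k / fact k) *\<^sub>R du k t)) \<le> M * \<bar>t + \<tau> - t\<bar> ^ 2"
      using M t u_deriv by (intro taylor_remainder_bound[where I = "{0..T}"]) auto
    also have "\<dots> \<le> L * \<tau>\<^sup>2"
      using L \<tau> by (simp add: mult_right_mono)
    finally have \<eta>: "norm (du 0 (t + \<tau>) - du 0 t - \<tau> *\<^sub>R (\<Sum>i\<in>UNIV. b $ i *\<^sub>R du 1 t)) \<le> L * \<tau>\<^sup>2"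
      using bsum by (simp add: numeral_2_eq_2 scaleR_sum_left[symmetric] algebra_simps)
    have \<delta>: "Z i - du 0 t - \<tau> *\<^sub>R (\<Sum>j\<in>UNIV. a $ i $ j *\<^sub>R du 1 t) = 0" for i
      by (simp add: Z_def rk_node_def scaleR_sum_left[symmetric] mult.commute)
    show ?thesis
      unfolding approx_step_def
      by (rule exI[of _ Z], rule exI[of _ "\<lambda>i. du 1 t"], rule exI[of _ V], rule exI[of _ "\<lambda>i. 0"], rule exI[of _ r])
        (use ZV SZ r \<eta> \<delta> in \<open>auto simp: J_simps S_simps linear_0[OF J_linear] linear_0[OF S_linear]\<close>)
  qed
  then show ?thesis
    using L(3) by blast
qed

section \<open>Convergence\<close>

text \<open>
  The first alternative is for steps with all \<open>t + c\<^sub>i \<tau>\<close> in \<open>[0, T]\<close>.  The second one holds in every step but is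
  useful only in boundedly many of them; it needs \<open>q \<le> 1\<close> because the tangent is accurate
  to \<open>O(\<tau>\<^sup>2)\<close> only.
\<close>

lemma error_recursion:
  fixes a :: "real^'m::finite^'m" and b :: "real^'m"
  assumes coer: "coercive a" and stab: "algebraically_stable a b"
    and a: "stage_order a q" and b: "quadrature_order_ge a b (q + 1)"
  shows "\<exists>\<tau>1>0. \<exists>K\<ge>0. \<forall>\<tau> t w w1 U.
      0 < \<tau> \<and> \<tau> \<le> \<tau>1 \<and> t \<in> {0..T} \<and> t + \<tau> \<in> {0..T} \<and> rk_step a b \<tau> w w1 U \<and> (\<forall>i. norm (U i) \<le> \<rho>)
      \<longrightarrow> ((\<forall>i. t + rk_node a i * \<tau> \<in> {0..T}) \<longrightarrow>
            (norm (w1 - du 0 (t + \<tau>)))\<^sup>2 + (\<tau> ^ (q + 1))\<^sup>2 \<le> (1 + K * \<tau>) * ((norm (w - du 0 t))\<^sup>2 + (\<tau> ^ (q + 1))\<^sup>2)) \<and>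
          (q \<le> 1 \<longrightarrow>
            (norm (w1 - du 0 (t + \<tau>)))\<^sup>2 + (\<tau> ^ (q + 1))\<^sup>2 \<le> (1 + K) * ((norm (w - du 0 t))\<^sup>2 + (\<tau> ^ (q + 1))\<^sup>2))"
proof -
  obtain M where M: "M \<ge> 1" "\<And>j t. j \<le> q + 2 \<Longrightarrow> t \<in> {0..T} \<Longrightarrow> norm (du j t) \<le> M"
    "\<And>j t. j \<le> q + 1 \<Longrightarrow> t \<in> {0..T} \<Longrightarrow> norm (dv j t) \<le> M"
    using trajectory_bounded by blast
  define c where "c = (\<Sum>i\<in>UNIV. \<bar>rk_node a i\<bar>)"
  have c: "\<bar>rk_node a i\<bar> \<le> c" for i
    unfolding c_def by (intro member_le_sum) auto
  have c0: "c \<ge> 0"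
    unfolding c_def by (intro sum_nonneg) auto
  define R where "R = max \<rho> (M * (1 + c))"
  have "M * 1 \<le> M * (1 + c)"
    using M c0 by (intro mult_left_mono) auto
  then have R: "M \<le> R" "0 < R" "M * (1 + c) \<le> R" "\<rho> \<le> R"
    using M(1) unfolding R_def by linarith+
  obtain \<tau>0 H where \<tau>0: "\<tau>0 > 0" and H: "H \<ge> 0"
    and stable: "\<forall>\<tau> w w1 U v v1 \<epsilon> \<beta> \<eta>.
      0 < \<tau> \<and> \<tau> \<le> \<tau>0 \<and> rk_step a b \<tau> w w1 U \<and> (\<forall>i. norm (U i) \<le> R) \<and> approx_step a b R \<tau> v v1 \<epsilon> \<beta> \<eta>
      \<longrightarrow> (\<exists>p\<ge>0. norm (w1 - v1) \<le> p + \<eta> \<and>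
            p\<^sup>2 \<le> (norm (w - v))\<^sup>2 + H * (norm (w - v) + \<epsilon> + \<tau> * \<beta>) * (\<tau> * (norm (w - v) + \<epsilon>) + \<tau> * \<beta>))"
    using rk_step_stability[OF coer stab R(2)] by blast
  have "\<exists>L\<ge>0. \<forall>\<tau> t. 0 < \<tau> \<and> t \<in> {0..T} \<and> t + \<tau> \<in> {0..T} \<and> (\<forall>i. t + rk_node a i * \<tau> \<in> {0..T}) \<longrightarrow>
      approx_step a b R \<tau> (du 0 t) (du 0 (t + \<tau>)) (L * \<tau> ^ (q + 1)) 0 (L * \<tau> ^ (q + 2))"
    using M(1) R(1) by (intro interior_step_defects[OF a b, of M]) (auto intro: M order_trans[OF M(2)] order_trans[OF M(3)])
  then obtain L1 where L1: "L1 \<ge> 0" and interior: "\<And>\<tau> t. 0 < \<tau> \<Longrightarrow> t \<in> {0..T} \<Longrightarrow> t + \<tau> \<in> {0..T} \<Longrightarrow>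
      (\<And>i. t + rk_node a i * \<tau> \<in> {0..T}) \<Longrightarrow>
      approx_step a b R \<tau> (du 0 t) (du 0 (t + \<tau>)) (L1 * \<tau> ^ (q + 1)) 0 (L1 * \<tau> ^ (q + 2))"
    by blast
  have "\<exists>L\<ge>0. \<forall>\<tau> t. 0 < \<tau> \<and> \<tau> \<le> 1 \<and> t \<in> {0..T} \<and> t + \<tau> \<in> {0..T} \<longrightarrow>
      approx_step a b R \<tau> (du 0 t) (du 0 (t + \<tau>)) 0 (L * \<tau>) (L * \<tau>\<^sup>2)"
    using M R c by (intro boundary_step_defects[OF b, where M = M and c = c]) auto
  then obtain L2 where L2: "L2 \<ge> 0" and boundary: "\<And>\<tau> t. 0 < \<tau> \<Longrightarrow> \<tau> \<le> 1 \<Longrightarrow> t \<in> {0..T} \<Longrightarrow> t + \<tau> \<in> {0..T} \<Longrightarrow>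
      approx_step a b R \<tau> (du 0 t) (du 0 (t + \<tau>)) 0 (L2 * \<tau>) (L2 * \<tau>\<^sup>2)"
    by blast
  define G where "G L = 1 + 4 * H * (1 + L\<^sup>2) + 2 * L\<^sup>2" for L
  have G: "G L \<ge> 0" for L
    unfolding G_def using H by (intro add_nonneg_nonneg mult_nonneg_nonneg) auto
  show ?thesis
  proof (rule exI[of _ "min 1 \<tau>0"], rule conjI, use \<tau>0 in simp, rule exI[of _ "max (G L1) (G L2)"], rule conjI,
      use G in \<open>simp add: le_max_iff_disj\<close>, intro allI impI, elim conjE)
    fix \<tau> t w w1 U
    assume \<tau>: "0 < \<tau>" "\<tau> \<le> min 1 \<tau>0" and t: "t \<in> {0..T}" "t + \<tau> \<in> {0..T}"
      and step: "rk_step a b \<tau> w w1 U" and U: "\<forall>i. norm (U i) \<le> \<rho>"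
    have U': "\<forall>i. norm (U i) \<le> R"
      using U R order_trans by blast
    define x where "x = norm (w - du 0 t)"
    define y where "y = norm (w1 - du 0 (t + \<tau>))"
    define e where "e = \<tau> ^ (q + 1)"
    have e: "0 \<le> e"
      using \<tau> by (simp add: e_def)
    have xy: "0 \<le> x" "0 \<le> y"
      by (auto simp: x_def y_def)
    have "y\<^sup>2 + e\<^sup>2 \<le> (1 + max (G L1) (G L2) * \<tau>) * (x\<^sup>2 + e\<^sup>2)"
      if inside: "\<forall>i. t + rk_node a i * \<tau> \<in> {0..T}"
    proof -
      obtain p where "y \<le> p + L1 * \<tau> ^ (q + 2)"
        "p\<^sup>2 \<le> x\<^sup>2 + H * (x + L1 * e + \<tau> * 0) * (\<tau> * (x + L1 * e) + \<tau> * 0)"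
        using stable[rule_format, of \<tau> w w1 U "du 0 t" "du 0 (t + \<tau>)" "L1 * e" 0 "L1 * \<tau> ^ (q + 2)"]
          interior[OF \<tau>(1) t inside[rule_format]] \<tau> step U' unfolding x_def y_def e_def by auto
      then have "y\<^sup>2 + e\<^sup>2 \<le> (1 + G L1 * \<tau>) * (x\<^sup>2 + e\<^sup>2)"
        unfolding G_def using \<tau> H xy
        by (intro perturbed_square_growth[where p = p]) (auto simp: e_def power2_eq_square mult_ac)
      also have "\<dots> \<le> (1 + max (G L1) (G L2) * \<tau>) * (x\<^sup>2 + e\<^sup>2)"
        using \<tau> by (intro mult_right_mono add_left_mono) auto
      finally show ?thesis .
    qed
    moreover have "y\<^sup>2 + e\<^sup>2 \<le> (1 + max (G L1) (G L2)) * (x\<^sup>2 + e\<^sup>2)" if "q \<le> 1"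
    proof -
      have small: "\<tau>\<^sup>2 \<le> e"
        unfolding e_def using \<tau> that by (intro power_decreasing) auto
      obtain p where p: "y \<le> p + L2 * \<tau>\<^sup>2"
        "p\<^sup>2 \<le> x\<^sup>2 + H * (x + 0 + \<tau> * (L2 * \<tau>)) * (\<tau> * (x + 0) + \<tau> * (L2 * \<tau>))"
        using stable[rule_format, of \<tau> w w1 U "du 0 t" "du 0 (t + \<tau>)" 0 "L2 * \<tau>" "L2 * \<tau>\<^sup>2"]
          boundary[OF \<tau>(1) _ t] \<tau> step U' by (auto simp: x_def y_def e_def)
      have L2e: "L2 * \<tau>\<^sup>2 \<le> L2 * e"
        using small L2 by (intro mult_left_mono)
      have "\<tau> * x \<le> 1 * x"
        using \<tau> xy by (intro mult_right_mono) auto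
      then have "H * (x + L2 * \<tau>\<^sup>2) * (\<tau> * x + L2 * \<tau>\<^sup>2) \<le> H * (x + L2 * e) * (x + L2 * e)"
        using small L2e H xy L2 e \<tau> by (intro mult_mono mult_left_mono add_mono mult_nonneg_nonneg add_nonneg_nonneg) auto
      then have "p\<^sup>2 \<le> x\<^sup>2 + H * 1 * (x + L2 * e)\<^sup>2"
        using p(2) by (simp add: power2_eq_square mult_ac)
      then have "y\<^sup>2 + e\<^sup>2 \<le> (1 + G L2 * 1) * (x\<^sup>2 + e\<^sup>2)"
        unfolding G_def using H xy p(1) L2e by (intro perturbed_square_growth[where p = p]) auto
      also have "\<dots> \<le> (1 + max (G L1) (G L2)) * (x\<^sup>2 + e\<^sup>2)"
        by (intro mult_right_mono) auto
      finally show ?thesis .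
    qed
    ultimately show "((\<forall>i. t + rk_node a i * \<tau> \<in> {0..T}) \<longrightarrow>
            (norm (w1 - du 0 (t + \<tau>)))\<^sup>2 + (\<tau> ^ (q + 1))\<^sup>2
              \<le> (1 + max (G L1) (G L2) * \<tau>) * ((norm (w - du 0 t))\<^sup>2 + (\<tau> ^ (q + 1))\<^sup>2)) \<and>
          (q \<le> 1 \<longrightarrow>
            (norm (w1 - du 0 (t + \<tau>)))\<^sup>2 + (\<tau> ^ (q + 1))\<^sup>2
              \<le> (1 + max (G L1) (G L2)) * ((norm (w - du 0 t))\<^sup>2 + (\<tau> ^ (q + 1))\<^sup>2))"
      unfolding x_def y_def e_def by blast
  qed
qed

text \<open>
  The exponential in \<open>C\<close> is the product of all growth factors: \<open>1 + K * \<tau>\<close> for ordinary steps, \<open>1 + K\<close> for at most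
  \<open>2 * N\<close> steps near the end points.  The constants are taken for stages bounded by \<open>\<bar>Cst\<bar> * \<rho>\<close>, that is for \<open>u\<^sub>n\<close> in a ball
  of radius \<open>\<rho>\<close> that contains all points at distance at most 1 from the trajectory; for small \<open>\<tau>\<close> the error bound itself keeps \<open>u\<^sub>n\<close> there, which also
  provides the stages of the next step.
\<close>

lemma convergence:
  fixes a :: "real^'m::finite^'m" and b :: "real^'m"
  assumes coer: "coercive a" and stab: "algebraically_stable a b"
    and a: "stage_order a q" and b: "quadrature_order_ge a b (q + 1)"
    and nodes: "q \<ge> 2 \<Longrightarrow> \<forall>i. 0 \<le> rk_node a i \<and> rk_node a i \<le> 1"
    and stages: "stage_constant J A a Cst"
  shows "\<exists>\<tau>bar>0. \<exists>C. \<forall>\<tau>. 0 < \<tau> \<and> \<tau> \<le> \<tau>bar \<longrightarrow>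
           (\<exists>un U. rk_solution J A a b Cst T \<tau> (du 0 0) un U) \<and>
           (\<forall>un U. rk_solution J A a b Cst T \<tau> (du 0 0) un U \<longrightarrow>
              (\<forall>n. real n * \<tau> \<le> T \<longrightarrow> norm (un n - du 0 (real n * \<tau>)) \<le> C * \<tau> ^ (q + 1)))"
proof -
  obtain M where M: "M \<ge> 1" "\<And>j t. j \<le> q + 2 \<Longrightarrow> t \<in> {0..T} \<Longrightarrow> norm (du j t) \<le> M"
    "\<And>j t. j \<le> q + 1 \<Longrightarrow> t \<in> {0..T} \<Longrightarrow> norm (dv j t) \<le> M"
    using trajectory_bounded by blast
  define \<rho> where "\<rho> = M + 1"
  have "\<rho> > 0"
    using M by (simp add: \<rho>_def)
  then obtain \<tau>s where \<tau>s: "\<tau>s > 0" and unique: "\<forall>\<tau>. 0 < \<tau> \<and> \<tau> \<le> \<tau>s \<longrightarrow>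
      (\<forall>w. norm w \<le> \<rho> \<longrightarrow> (\<exists>!U. rk_stages J A a Cst \<tau> w U))"
    using stages[unfolded stage_constant_def, rule_format, of \<rho>] by blast
  have stages_exist: "\<exists>U. rk_stages J A a Cst \<tau> w U" if "0 < \<tau>" "\<tau> \<le> \<tau>s" "norm w \<le> \<rho>" for \<tau> w
    using unique that by (simp add: ex1_implies_ex)
  obtain \<tau>1 K where \<tau>1: "\<tau>1 > 0" and K: "K \<ge> 0" and recursion: "\<forall>\<tau> t w w1 U.
      0 < \<tau> \<and> \<tau> \<le> \<tau>1 \<and> t \<in> {0..T} \<and> t + \<tau> \<in> {0..T} \<and> rk_step a b \<tau> w w1 U \<and> (\<forall>i. norm (U i) \<le> \<bar>Cst\<bar> * \<rho>)
      \<longrightarrow> ((\<forall>i. t + rk_node a i * \<tau> \<in> {0..T}) \<longrightarrow>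
            (norm (w1 - du 0 (t + \<tau>)))\<^sup>2 + (\<tau> ^ (q + 1))\<^sup>2 \<le> (1 + K * \<tau>) * ((norm (w - du 0 t))\<^sup>2 + (\<tau> ^ (q + 1))\<^sup>2)) \<and>
          (q \<le> 1 \<longrightarrow>
            (norm (w1 - du 0 (t + \<tau>)))\<^sup>2 + (\<tau> ^ (q + 1))\<^sup>2 \<le> (1 + K) * ((norm (w - du 0 t))\<^sup>2 + (\<tau> ^ (q + 1))\<^sup>2))"
    using error_recursion[OF coer stab a b, of "\<bar>Cst\<bar> * \<rho>"] by (elim exE conjE) (rule that)
  obtain N :: nat where "(\<Sum>i\<in>UNIV. \<bar>rk_node a i\<bar>) \<le> real N"
    using real_arch_simple by blast
  then have N: "\<bar>rk_node a i\<bar> \<le> real N" for i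
    by (rule order_trans[rotated]) (auto intro: member_le_sum)
  define C where "C = exp (K * T + 2 * real N * K)"
  have C: "C \<ge> 1"
    using K T_pos by (simp add: C_def)
  \<comment> \<open>The entry \<open>1 / C\<close> makes the error at most 1, which keeps the numerical solution in the ball of radius \<open>\<rho>\<close>.\<close>
  define \<tau>bar where "\<tau>bar = min (min \<tau>1 \<tau>s) (min 1 (1 / C))"
  have \<tau>bar: "\<tau>bar > 0"
    using \<tau>1 \<tau>s C by (simp add: \<tau>bar_def)
  define stepped where "stepped \<tau> un U n \<longleftrightarrow> (\<forall>k<n. rk_stages J A a Cst \<tau> (un k) (U k) \<and>
      J (un (Suc k)) = J (un k) + \<tau> *\<^sub>R (\<Sum>i\<in>UNIV. b $ i *\<^sub>R stage_dot J A (U k i)))"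
    for \<tau> un U and n :: nat
  have close: "norm (un n) \<le> \<rho>"
    if "0 < \<tau>" "\<tau> \<le> \<tau>bar" "real n * \<tau> \<le> T" "norm (un n - du 0 (real n * \<tau>)) \<le> C * \<tau> ^ (q + 1)" for \<tau> un n
  proof -
    have "\<tau> ^ (q + 1) \<le> \<tau> ^ 1"
      using that by (intro power_decreasing) (auto simp: \<tau>bar_def)
    then have "C * \<tau> ^ (q + 1) \<le> C * \<tau>"
      using C by simp
    also have "\<dots> \<le> 1"
      using that C by (simp add: \<tau>bar_def pos_le_divide_eq mult.commute)
    finally have "norm (un n - du 0 (real n * \<tau>)) \<le> 1"
      using that by linarith
    moreover have "norm (du 0 (real n * \<tau>)) \<le> M"
      using that by (intro M) auto
    ultimately show ?thesis
      unfolding \<rho>_def using norm_triangle_sub[of "un n" "du 0 (real n * \<tau>)"] by linarith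
  qed
  have bound: "norm (un n - du 0 (real n * \<tau>)) \<le> C * \<tau> ^ (q + 1)"
    if \<tau>: "0 < \<tau>" "\<tau> \<le> \<tau>bar" and un0: "un 0 = du 0 0" and "stepped \<tau> un U n" "real n * \<tau> \<le> T" for \<tau> un U n
    using that(4,5)
  proof (induction n rule: less_induct)
    case (less n)
    define e where "e = \<tau> ^ (q + 1)"
    define z where "z k = (norm (un k - du 0 (real k * \<tau>)))\<^sup>2 + e\<^sup>2" for k
    define \<gamma> where "\<gamma> k = (if k < N \<or> real (k + N) * \<tau> > T then K else K * \<tau>)" for k
    have "z (Suc k) \<le> (1 + \<gamma> k) * z k" if k: "k < n" for k
    proof -
      have "real (Suc k) * \<tau> \<le> real n * \<tau>"
        using k \<tau> by (intro mult_right_mono) auto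
      then have kT: "real (Suc k) * \<tau> \<le> T"
        using less.prems by linarith
      then have kT': "real k * \<tau> + \<tau> \<le> T" "real k * \<tau> \<le> T"
        using \<tau> by (auto simp: algebra_simps)
      have "norm (un k - du 0 (real k * \<tau>)) \<le> C * \<tau> ^ (q + 1)"
        using less.IH[OF k] less.prems k kT' by (auto simp: stepped_def)
      then have w: "norm (un k) \<le> \<rho>"
        using close \<tau> kT' by blast
      have st: "rk_stages J A a Cst \<tau> (un k) (U k)"
        and nx: "J (un (Suc k)) = J (un k) + \<tau> *\<^sub>R (\<Sum>i\<in>UNIV. b $ i *\<^sub>R stage_dot J A (U k i))"
        using less.prems k by (auto simp: stepped_def)
      have "norm (U k i) \<le> \<bar>Cst\<bar> * \<rho>" for i
      proof -
        have "norm (U k i) \<le> Cst * norm (un k)"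
          using st by (simp add: rk_stages_def)
        also have "\<dots> \<le> \<bar>Cst\<bar> * \<rho>"
          using w by (intro mult_mono) auto
        finally show ?thesis .
      qed
      moreover have "rk_step a b \<tau> (un k) (un (Suc k)) (U k)"
        using st nx by (simp add: rk_stages_def rk_step_def)
      moreover have Suc_k: "real k * \<tau> + \<tau> = real (Suc k) * \<tau>"
        by (simp add: algebra_simps)
      ultimately have int: "(\<forall>i. real k * \<tau> + rk_node a i * \<tau> \<in> {0..T}) \<Longrightarrow> z (Suc k) \<le> (1 + K * \<tau>) * z k"
        and bdy: "q \<le> 1 \<Longrightarrow> z (Suc k) \<le> (1 + K) * z k"
        using recursion[rule_format, of \<tau> "real k * \<tau>" "un k" "un (Suc k)" "U k"] \<tau> kT'
        unfolding z_def e_def Suc_k[symmetric] by (simp_all add: \<tau>bar_def)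
      show ?thesis
      proof (cases "\<forall>i. real k * \<tau> + rk_node a i * \<tau> \<in> {0..T}")
        case True
        have "K * \<tau> \<le> K * 1"
          using K \<tau> by (intro mult_left_mono) (auto simp: \<tau>bar_def)
        then have "(1 + K * \<tau>) * z k \<le> (1 + \<gamma> k) * z k"
          by (intro mult_right_mono) (auto simp: \<gamma>_def z_def)
        then show ?thesis
          using int[OF True] by linarith
      next
        case False
        then obtain i where i: "real k * \<tau> + rk_node a i * \<tau> \<notin> {0..T}"
          by blast
        have "q \<le> 1"
        proof (rule ccontr)
          assume "\<not> q \<le> 1"
          then have "0 \<le> rk_node a i" "rk_node a i \<le> 1"
            using nodes by auto
          then have "0 \<le> rk_node a i * \<tau>" "rk_node a i * \<tau> \<le> 1 * \<tau>"
            using \<tau> by (auto intro: mult_right_mono simp del: mult_1)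
          moreover have "0 \<le> real k * \<tau>"
            using \<tau> by simp
          ultimately show False
            using i kT' by simp
        qed
        have upper: "(real k + rk_node a i) * \<tau> \<le> real (k + N) * \<tau>"
          using N[of i] \<tau> by (intro mult_right_mono) auto
        have "(real k + rk_node a i) * \<tau> < 0 \<or> (real k + rk_node a i) * \<tau> > T"
          using i unfolding distrib_right by auto
        then have "real k + rk_node a i < 0 \<or> real (k + N) * \<tau> > T"
          using upper \<tau>(1) by (metis less_le_trans mult_less_cancel_right_pos mult_zero_left)
        then have "\<gamma> k = K"
          using N[of i] by (auto simp: \<gamma>_def)
        then show ?thesis
          using bdy[OF \<open>q \<le> 1\<close>] by simp
      qed
    qed
    then have "z n \<le> exp (\<Sum>k<n. \<gamma> k) * z 0"
      using K \<tau> by (intro discrete_gronwall) (auto simp: z_def \<gamma>_def)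
    also have "\<dots> \<le> C * z 0"
      unfolding C_def \<gamma>_def using sum_boundary_weights_le[OF K \<tau>(1) less.prems(2), of N]
      by (intro mult_right_mono) (auto simp: z_def)
    also have "\<dots> \<le> (C * e)\<^sup>2"
      using un0 C by (simp add: z_def power_mult_distrib) (simp add: power2_eq_square mult_right_mono)
    finally have "(norm (un n - du 0 (real n * \<tau>)))\<^sup>2 + e\<^sup>2 \<le> (C * e)\<^sup>2"
      unfolding z_def .
    then have "(norm (un n - du 0 (real n * \<tau>)))\<^sup>2 \<le> (C * e)\<^sup>2"
      using zero_le_power2[of e] by linarith
    then show ?case
      unfolding e_def by (rule power2_le_imp_le) (use C \<tau> in simp)
  qed
  have exist: "\<exists>un U. rk_solution J A a b Cst T \<tau> (du 0 0) un U" if \<tau>: "0 < \<tau>" "\<tau> \<le> \<tau>bar" for \<tau>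
  proof -
    define P where "P w w1 V \<longleftrightarrow> rk_stages J A a Cst \<tau> w V \<and>
        J w1 = J w + \<tau> *\<^sub>R (\<Sum>i\<in>UNIV. b $ i *\<^sub>R stage_dot J A (V i))" for w w1 V
    \<comment> \<open>The iteration is defined for all \<open>n\<close>; beyond time \<open>T\<close> its values are arbitrary.\<close>
    define un where "un n = ((\<lambda>w. SOME w1. \<exists>V. P w w1 V) ^^ n) (du 0 0)" for n
    define U where "U n = (SOME V. P (un n) (un (Suc n)) V)" for n
    have P: "P (un n) (un (Suc n)) (U n)" if w: "norm (un n) \<le> \<rho>" for n
    proof -
      obtain V where V: "rk_stages J A a Cst \<tau> (un n) V"
        using stages_exist[of \<tau> "un n"] \<tau> w by (auto simp: \<tau>bar_def)
      have "stage_dot J A (V i) \<in> range J" for i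
        using V coer \<tau> by (intro stage_dot_in_Y[of a]) (auto simp: rk_stages_def coercive_def)
      then have "J (inv J (stage_dot J A (V i))) = stage_dot J A (V i)" for i
        by (rule f_inv_into_f)
      then have "P (un n) (un n + \<tau> *\<^sub>R (\<Sum>i\<in>UNIV. b $ i *\<^sub>R inv J (stage_dot J A (V i)))) V"
        using V by (simp add: P_def J_simps)
      then have "\<exists>w1 V. P (un n) w1 V"
        by blast
      then have "\<exists>V. P (un n) (SOME w1. \<exists>V. P (un n) w1 V) V"
        by (rule someI_ex)
      then have "\<exists>V. P (un n) (un (Suc n)) V"
        by (simp add: un_def)
      then show ?thesis
        unfolding U_def by (rule someI_ex)
    qed
    have un0: "un 0 = du 0 0"
      by (simp add: un_def)
    have "stepped \<tau> un U n" if "real n * \<tau> \<le> T" for n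
      using that
    proof (induction n)
      case 0
      then show ?case by (simp add: stepped_def)
    next
      case (Suc n)
      have nT: "real n * \<tau> \<le> T"
        using Suc.prems \<tau> by (simp add: algebra_simps)
      then have "norm (un n) \<le> \<rho>"
        using close[OF \<tau> nT] bound[of \<tau> un U n] \<tau> un0 Suc.IH by blast
      then show ?case
        using P[of n] Suc.IH[OF nT] by (auto simp: stepped_def P_def less_Suc_eq)
    qed
    then have "stepped \<tau> un U (Suc n)" if "real (Suc n) * \<tau> \<le> T" for n
      using that .
    then have "rk_solution J A a b Cst T \<tau> (du 0 0) un U"
      using un0 unfolding rk_solution_def stepped_def by blast
    then show ?thesis by blast
  qed
  have "norm (un n - du 0 (real n * \<tau>)) \<le> C * \<tau> ^ (q + 1)"
    if \<tau>: "0 < \<tau>" "\<tau> \<le> \<tau>bar" and sol: "rk_solution J A a b Cst T \<tau> (du 0 0) un U" and n: "real n * \<tau> \<le> T" for \<tau> un U n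
  proof (rule bound[OF \<tau> _ _ n])
    have "real (Suc k) * \<tau> \<le> T" if "k < n" for k
    proof -
      have "real (Suc k) * \<tau> \<le> real n * \<tau>"
        using that \<tau> by (intro mult_right_mono) auto
      then show ?thesis
        using n by linarith
    qed
    then show "stepped \<tau> un U n"
      using sol unfolding stepped_def rk_solution_def by blast
    show "un 0 = du 0 0"
      using sol by (simp add: rk_solution_def)
  qed
  then show ?thesis
    using \<tau>bar exist by blast
qed

end

theorem theorem4p1:
  fixes J :: "'y::{real_inner, complete_space} \<Rightarrow> 'x::{real_inner, complete_space}"
    and DA :: "'y \<Rightarrow> 'x set"
    and A B :: "'y \<Rightarrow> 'x \<Rightarrow> 'x"
    and S :: "'y \<Rightarrow> 'x"
    and MA MB LA LB :: "real \<Rightarrow> real"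
    and a :: "real^'m^'m" and b :: "real^'m"
    and q :: nat
    and Cst T :: real
    and u :: "real \<Rightarrow> 'y"
  assumes "dense_embedding J"
    and "\<And>y. closed_linear_operator (DA y) (A y)"
    and "cond_K1 J DA A MA"
    and "cond_K2 J DA A B S MB"
    and "cond_K3 J A B LA LB"
    and "T > 0"
    and "solution_on J A {0..T} u"
    and "C_k_on (q + 2) {0..T} u"
    and "\<exists>v. (\<forall>t\<in>{0..T}. S (u t) = J (v t)) \<and> C_k_on (q + 1) {0..T} v"
    and "algebraically_stable a b"
    and "coercive a"
    and "stage_order a q"
    and "quadrature_order_ge a b (q + 1)"
    and "q \<ge> 2 \<Longrightarrow> \<forall>i. 0 \<le> rk_node a i \<and> rk_node a i \<le> 1"
    and "stage_constant J A a Cst"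
  shows "\<exists>\<tau>bar>0. \<exists>C. \<forall>\<tau>. 0 < \<tau> \<and> \<tau> \<le> \<tau>bar \<longrightarrow>
           (\<exists>un U. rk_solution J A a b Cst T \<tau> (u 0) un U) \<and>
           (\<forall>un U. rk_solution J A a b Cst T \<tau> (u 0) un U \<longrightarrow>
              (\<forall>n. real n * \<tau> \<le> T \<longrightarrow>
                 norm (un n - u (real n * \<tau>)) \<le> C * \<tau> ^ (q + 1)))"
proof -
  obtain d where d0: "\<And>t. t \<in> {0..T} \<Longrightarrow> d 0 t = u t"
    and d: "\<And>j t. j < q + 2 \<Longrightarrow> t \<in> {0..T} \<Longrightarrow> (d j has_vector_derivative d (Suc j) t) (at t within {0..T})"
      "\<And>j. j \<le> q + 2 \<Longrightarrow> continuous_on {0..T} (d j)"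
    using assms(8) unfolding C_k_on_def by blast
  obtain v dv where Sv: "\<And>t. t \<in> {0..T} \<Longrightarrow> S (u t) = J (v t)"
    and dv0: "\<And>t. t \<in> {0..T} \<Longrightarrow> dv 0 t = v t"
    and dv: "\<And>j t. j < q + 1 \<Longrightarrow> t \<in> {0..T} \<Longrightarrow> (dv j has_vector_derivative dv (Suc j) t) (at t within {0..T})"
      "\<And>j. j \<le> q + 1 \<Longrightarrow> continuous_on {0..T} (dv j)"
    using assms(9) unfolding C_k_on_def by blast
  have sol: "solution_on J A {0..T} (d 0)"
    unfolding solution_on_def
  proof
    fix t assume t: "t \<in> {0..T}"
    have "((\<lambda>s. J (u s)) has_vector_derivative - A (d 0 t) (J (d 0 t))) (at t within {0..T})"
      using assms(7) t by (simp add: solution_on_def d0)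
    then show "((\<lambda>s. J (d 0 s)) has_vector_derivative - A (d 0 t) (J (d 0 t))) (at t within {0..T})"
      by (rule has_vector_derivative_transform[OF t, rotated]) (simp add: d0)
  qed
  interpret kato_trajectory J DA A B S MA MB LA LB T q d dv
    using assms(1-6) d dv sol by unfold_locales (simp_all add: d0 Sv dv0)
  have u0: "d 0 0 = u 0" and un: "\<And>n \<tau>. 0 < \<tau> \<Longrightarrow> real n * \<tau> \<le> T \<Longrightarrow> d 0 (real n * \<tau>) = u (real n * \<tau>)"
    using d0 assms(6) by simp_all
  obtain \<tau>bar C where "\<tau>bar > 0" and "\<forall>\<tau>. 0 < \<tau> \<and> \<tau> \<le> \<tau>bar \<longrightarrow>
      (\<exists>un U. rk_solution J A a b Cst T \<tau> (d 0 0) un U) \<and>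
      (\<forall>un U. rk_solution J A a b Cst T \<tau> (d 0 0) un U \<longrightarrow>
        (\<forall>n. real n * \<tau> \<le> T \<longrightarrow> norm (un n - d 0 (real n * \<tau>)) \<le> C * \<tau> ^ (q + 1)))"
    using convergence[OF assms(11,10,12,13,14,15)] by blast
  then show ?thesis
    using un unfolding u0 by (intro exI[of _ \<tau>bar] conjI exI[of _ C]) auto
qed

end
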